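(* Let $\lambda_0>0$ and let $p_0=(p_{0,k})_{k\in\mathbb{N}}$ be a probability mass function on $\mathbb{N}=\{1,2,\dots\}$, with Lévy measure $\nu_0=\lambda_0p_0$. Let $Z_1,Z_2,\dots$ be i.i.d. with distribution $Q_0$ on $\mathbb{N}_0$ having mass function $q_0=q_{\lambda_0,p_0}$, and put $\mathcal{Z}_n=(Z_1,\dots,Z_n)$. Let $m=m_n$ be positive integers depending on $n$, with $m_n\to\infty$ at a suitable rate as $n\to\infty$, and let $\Pi_n$ be the prior on $(\lambda,p)$ (equivalently on $\nu=\lambda p$) under which $\lambda$ has a prior distribution; independently, $(p_1,\dots,p_{m_n})\sim\mathrm{Dirichlet}(\alpha_1,\dots,\alpha_{m_n})$; and $p_k=0$ for all $k>m_n$. Suppose there exists $\underline{\alpha}$ such that $0<\underline{\alpha}\le\alpha_i\le 1$ for all $1\le i\le m_n$. Suppose $\lambda\sim\mathrm{Gamma}(a,b)$ with $a\in(0,1]$, and that $\nu_0$ has a compact support. Then, for any $\gamma>1$, $$\Pi_n\left(\|\nu-\nu_0\|_1\ge\frac{\log^{\gamma}n}{\sqrt n}\;\middle|\;\mathcal{Z}_n\right)\to0$$ in $Q_0^n$-probability, as $n\to\infty$.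
   Context: For $\lambda>0$ and a probability mass function $p$ on $\mathbb{N}$, $q_{\lambda,p}=e^{-\lambda}\sum_{j=0}^\infty\frac{\lambda^j}{j!}p^{*j}$ (with $*$ convolution of sequences indexed by $\mathbb{N}_0$ and $p^{*0}$ the point mass at $0$) is the law of $\sum_{j=1}^{N}Y_j$ with $N\sim\mathrm{Poisson}(\lambda)$ independent of the i.i.d. $Y_j\sim p$, i.e. the law at time 1 of the compound Poisson process with intensity $\lambda$ and jump distribution $p$; the $Z_i$ are the increments of such a process observed at times $t_i=i$. The Lévy measure is the sequence $\nu=\lambda p=(\nu_k)_{k\in\mathbb{N}}$, and $\|\nu-\nu'\|_1=\sum_{k}|\nu_k-\nu_k'|$. $\mathrm{Gamma}(a,b)$, with $a,b>0$, has density $\frac{b^a}{\Gamma(a)}x^{a-1}e^{-bx}$ on $x>0$. The posterior is $$\Pi_n(A\mid\mathcal{Z}_n)=\frac{\int_A\prod_{i=1}^nq_{\lambda,p}(Z_i)\,d\Pi_n(\lambda,p)}{\int\prod_{i=1}^nq_{\lambda,p}(Z_i)\,d\Pi_n(\lambda,p)}.$$ The statement itself does not specify the rate at which $m_n\to\infty$; the choice made in its proof is $m_n$ of the exact order $\log n$. *)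

theory Defs
  imports "HOL-Probability.Probability" "HOL-Library.Landau_Symbols"
begin

(* Sequences indexed by {1,2,...} are functions nat => real that vanish at 0. *)

definition is_pmf_pos :: "(nat \<Rightarrow> real) \<Rightarrow> bool" where
  "is_pmf_pos p \<longleftrightarrow> p 0 = 0 \<and> (\<forall>k. 0 \<le> p k) \<and> p sums 1"

definition conv :: "(nat \<Rightarrow> real) \<Rightarrow> (nat \<Rightarrow> real) \<Rightarrow> nat \<Rightarrow> real" where
  "conv f g k = (\<Sum>i\<le>k. f i * g (k - i))"

primrec conv_power :: "(nat \<Rightarrow> real) \<Rightarrow> nat \<Rightarrow> nat \<Rightarrow> real" where
  "conv_power p 0 = (\<lambda>k. if k = 0 then 1 else 0)"
| "conv_power p (Suc j) = conv p (conv_power p j)"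

definition compound_poisson :: "real \<Rightarrow> (nat \<Rightarrow> real) \<Rightarrow> nat \<Rightarrow> real" where
  "compound_poisson l p k = exp (- l) * (\<Sum>j. l ^ j / fact j * conv_power p j k)"

definition levy :: "real \<Rightarrow> (nat \<Rightarrow> real) \<Rightarrow> nat \<Rightarrow> real" where
  "levy l p k = l * p k"

definition l1_dist :: "(nat \<Rightarrow> real) \<Rightarrow> (nat \<Rightarrow> real) \<Rightarrow> real" where
  "l1_dist u v = (\<Sum>k. \<bar>u k - v k\<bar>)"

definition gamma_dist :: "real \<Rightarrow> real \<Rightarrow> real measure" where
  "gamma_dist a b = density lborel
     (\<lambda>x. ennreal (if 0 < x then b powr a / Gamma a * x powr (a - 1) * exp (- b * x) else 0))"

(* Dirichlet(al 1, ..., al m), m >= 1: the first m - 1 coordinates have the usual density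
   with respect to Lebesgue measure on the open simplex, and the m-th one is the remaining mass.
   The result is carried over to sequences by padding with zeros; for m = 1 it is the point mass
   at the sequence with p 1 = 1. *)
definition dirichlet_density :: "nat \<Rightarrow> (nat \<Rightarrow> real) \<Rightarrow> (nat \<Rightarrow> real) \<Rightarrow> real" where
  "dirichlet_density m al x =
     (if (\<forall>i\<in>{1..<m}. 0 < x i) \<and> (\<Sum>i\<in>{1..<m}. x i) < 1
      then Gamma (\<Sum>i\<in>{1..m}. al i) / (\<Prod>i\<in>{1..m}. Gamma (al i))
           * (\<Prod>i\<in>{1..<m}. x i powr (al i - 1))
           * (1 - (\<Sum>i\<in>{1..<m}. x i)) powr (al m - 1)
      else 0)"

definition simplex_point :: "nat \<Rightarrow> (nat \<Rightarrow> real) \<Rightarrow> nat \<Rightarrow> real" where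
  "simplex_point m x k =
     (if k \<in> {1..<m} then x k else if k = m then 1 - (\<Sum>i\<in>{1..<m}. x i) else 0)"

definition dirichlet :: "nat \<Rightarrow> (nat \<Rightarrow> real) \<Rightarrow> (nat \<Rightarrow> real) measure" where
  "dirichlet m al =
     distr (density (PiM {1..<m} (\<lambda>_. lborel)) (\<lambda>x. ennreal (dirichlet_density m al x)))
           (PiM UNIV (\<lambda>_. borel)) (simplex_point m)"

definition prior ::
  "real \<Rightarrow> real \<Rightarrow> nat \<Rightarrow> (nat \<Rightarrow> real) \<Rightarrow> (real \<times> (nat \<Rightarrow> real)) measure" where
  "prior a b m al = gamma_dist a b \<Otimes>\<^sub>M dirichlet m al"

definition likelihood :: "nat \<Rightarrow> (nat \<Rightarrow> nat) \<Rightarrow> real \<times> (nat \<Rightarrow> real) \<Rightarrow> real" where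
  "likelihood n z = (\<lambda>(l, p). \<Prod>i\<in>{1..n}. compound_poisson l p (z i))"

definition posterior ::
  "(real \<times> (nat \<Rightarrow> real)) measure \<Rightarrow> nat \<Rightarrow> (nat \<Rightarrow> nat) \<Rightarrow> (real \<times> (nat \<Rightarrow> real)) set \<Rightarrow> real" where
  "posterior Pr n z A = (LINT t:A|Pr. likelihood n z t) / (LINT t|Pr. likelihood n z t)"

definition converges_in_prob :: "'w measure \<Rightarrow> (nat \<Rightarrow> 'w \<Rightarrow> real) \<Rightarrow> real \<Rightarrow> bool" where
  "converges_in_prob M X c \<longleftrightarrow>
     (\<forall>\<epsilon>>0. (\<lambda>n. measure M {w \<in> space M. \<bar>X n w - c\<bar> > \<epsilon>}) \<longlonglongrightarrow> 0)"

end

theory Submission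
  imports Defs "HOL-Computational_Algebra.Formal_Power_Series" "HOL-Real_Asymp.Real_Asymp"
begin

text \<open>
  The generating function of the law of the data is \<open>Q = exp (N - l)\<close>, where \<open>N\<close> is that of the Levy
  measure. The map from \<open>Q\<close> to \<open>N\<close> is Lipschitz near the truth for the \<open>l1\<close> norms, uniformly over all
  Levy measures, because \<open>exp (- N\<^sub>0)\<close> has finite \<open>l1\<close> norm; so Levy measures at \<open>l1\<close> distance \<open>\<epsilon>\<close> from the
  truth give laws at \<open>l1\<close> distance at least a multiple of \<open>\<epsilon>\<close>.

  The weight of the value \<open>k\<close> depends on the Levy measure, up to the factor \<open>exp (- l)\<close>, as a polynomial with
  nonnegative coefficients of degree at most \<open>k\<close>. Hence on a cell of mesh \<open>1 / (n m)\<close> the likelihood is at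
  most \<open>e\<close> times its value at the upper corner. A union bound over the \<open>exp (O (log\<^sup>2 n))\<close> cells with
  intensity at most \<open>n^3\<close>, with the Hellinger affinity as exponential moment, makes the likelihood ratio
  smaller than any \<open>exp (- O (log\<^sup>2 n))\<close> at distance \<open>log^\<gamma> n / sqrt n\<close>. By the same monotonicity
  the likelihood ratio is bounded below on a box of side \<open>1 / (n^3 m)\<close> near the truth, whose prior mass is at least
  \<open>exp (- O (log\<^sup>2 n))\<close> of the total.
\<close>

unbundle no vec_syntax
unbundle fps_syntax

subsection \<open>Truncated l1 norms of power series\<close>

text \<open>The rate comes from one comparison. With about \<open>log n\<close> free weights, the
  number of cells, the inverse prior mass of the box and the threshold put on the likelihood ratios
  are all \<open>exp (O (log^2 n))\<close>, whereas at the given radius the affinity bound is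
  \<open>exp (- k log^(2 \<gamma>) n)\<close>, which wins because \<gamma> > 1. Two unbounded
  quantities shape the rest. Intensities above \<open>n^3\<close> lie outside the grid and are left
  to the gamma tail; their mass, of order \<open>exp (- b n^3)\<close>, is compared with the
  likelihood of the truth, which is at least \<open>exp (- n^2)\<close> for typical data. Large
  observations spoil the lower bound near the truth, since a relative loss \<delta> in the Levy
  measure costs \<open>(1 - \<delta>) ^ z\<close> at the value \<open>z\<close>; a first moment
  bound keeps their sum below \<open>n^2\<close>, and \<open>\<delta> = 1 / n^3\<close> makes the
  total loss harmless. All l1 norms are truncated. Up to degree \<open>m\<close> the coefficients of
  \<open>N\<close> are determined by those of \<open>Q\<close>, so for Levy measures supported in
  \<open>{1..m}\<close> the distance is already visible in the probabilities of the values up to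
  \<open>m\<close>.\<close>

definition fps_l1 :: "nat \<Rightarrow> real fps \<Rightarrow> real" where
  "fps_l1 K f = (\<Sum>k\<le>K. \<bar>f $ k\<bar>)"

lemma fps_l1_nonneg: "0 \<le> fps_l1 K f"
  by (simp add: fps_l1_def sum_nonneg)

lemma fps_l1_diff: "fps_l1 K (f - g) \<le> fps_l1 K f + fps_l1 K g"
  unfolding fps_l1_def sum.distrib[symmetric] by (rule sum_mono) simp

lemma fps_l1_mono: "K \<le> L \<Longrightarrow> fps_l1 K f \<le> fps_l1 L f"
  unfolding fps_l1_def by (rule sum_mono2) auto

lemma fps_l1_1 [simp]: "fps_l1 K 1 = 1"
proof -
  have "fps_l1 K 1 = (\<Sum>k\<in>{0}. \<bar>1 $ k\<bar>)"
    unfolding fps_l1_def by (rule sum.mono_neutral_right) auto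
  then show ?thesis by simp
qed

lemma fps_l1_const_mult: "fps_l1 K (fps_const c * f) = \<bar>c\<bar> * fps_l1 K f"
  by (simp add: fps_l1_def abs_mult sum_distrib_left)

text \<open>In a product, degrees up to \<open>K\<close> only involve pairs with
  \<open>i + j \<le> K\<close>, a part of the full square. This is what makes the truncated norm
  submultiplicative.\<close>

lemma triangle_sum_le_product:
  fixes F G :: "nat \<Rightarrow> real"
  assumes "\<And>i. 0 \<le> F i" "\<And>i. 0 \<le> G i"
  shows "(\<Sum>k\<le>K. \<Sum>i\<le>k. F i * G (k - i)) \<le> (\<Sum>i\<le>K. F i) * (\<Sum>i\<le>K. G i)"
proof -
  have "(\<Sum>k\<le>K. \<Sum>i\<le>k. F i * G (k - i)) = (\<Sum>(i,j)\<in>{(i,j). i + j \<le> K}. F i * G j)"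
    by (simp add: sum.triangle_reindex_eq)
  also have "\<dots> \<le> (\<Sum>(i,j)\<in>{..K} \<times> {..K}. F i * G j)"
    by (rule sum_mono2) (auto simp: assms)
  also have "\<dots> = (\<Sum>i\<le>K. F i) * (\<Sum>i\<le>K. G i)"
    by (simp add: sum_product sum.cartesian_product)
  finally show ?thesis .
qed

lemma fps_l1_mult: "fps_l1 K (f * g) \<le> fps_l1 K f * fps_l1 K g"
proof -
  have "fps_l1 K (f * g) \<le> (\<Sum>k\<le>K. \<Sum>i\<le>k. \<bar>f $ i\<bar> * \<bar>g $ (k - i)\<bar>)"
    unfolding fps_l1_def fps_mult_nth atLeast0AtMost
    by (intro sum_mono order_trans[OF sum_abs]) (simp add: abs_mult)
  also have "\<dots> \<le> fps_l1 K f * fps_l1 K g"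
    unfolding fps_l1_def by (rule triangle_sum_le_product) auto
  finally show ?thesis .
qed

lemma fps_l1_power: "fps_l1 K (f ^ j) \<le> fps_l1 K f ^ j"
proof (induction j)
  case (Suc j)
  have "fps_l1 K (f ^ Suc j) \<le> fps_l1 K f * fps_l1 K (f ^ j)"
    using fps_l1_mult[of K f "f ^ j"] by simp
  also have "\<dots> \<le> fps_l1 K f * fps_l1 K f ^ j"
    using Suc by (intro mult_left_mono fps_l1_nonneg)
  finally show ?case by simp
qed simp

text \<open>The coefficient of degree \<open>k\<close> of a composition is by definition a finite
  sum over the powers \<open>i \<le> k\<close>. Extending it to \<open>i \<le> K\<close> and using
  submultiplicativity leaves a partial sum of the exponential series.\<close>

lemma fps_l1_exp_compose: "fps_l1 K (fps_exp c oo f) \<le> exp (\<bar>c\<bar> * fps_l1 K f)"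
proof -
  have "fps_l1 K (fps_exp c oo f) \<le> (\<Sum>k\<le>K. \<Sum>i\<le>K. \<bar>c\<bar> ^ i / fact i * \<bar>(f ^ i) $ k\<bar>)"
    unfolding fps_l1_def
  proof (rule sum_mono)
    fix k assume k: "k \<in> {..K}"
    have "\<bar>(fps_exp c oo f) $ k\<bar> \<le> (\<Sum>i\<le>k. \<bar>c\<bar> ^ i / fact i * \<bar>(f ^ i) $ k\<bar>)"
      unfolding fps_compose_nth atLeast0AtMost
      by (intro order_trans[OF sum_abs]) (simp add: abs_mult power_abs)
    also have "\<dots> \<le> (\<Sum>i\<le>K. \<bar>c\<bar> ^ i / fact i * \<bar>(f ^ i) $ k\<bar>)"
      using k by (intro sum_mono2) auto
    finally show "\<bar>(fps_exp c oo f) $ k\<bar> \<le> (\<Sum>i\<le>K. \<bar>c\<bar> ^ i / fact i * \<bar>(f ^ i) $ k\<bar>)" .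
  qed
  also have "\<dots> = (\<Sum>i\<le>K. \<bar>c\<bar> ^ i / fact i * fps_l1 K (f ^ i))"
    unfolding fps_l1_def sum_distrib_left by (rule sum.swap)
  also have "\<dots> \<le> (\<Sum>i\<le>K. \<bar>c\<bar> ^ i / fact i * fps_l1 K f ^ i)"
    by (intro sum_mono mult_left_mono fps_l1_power) auto
  also have "\<dots> = (\<Sum>i\<le>K. (\<bar>c\<bar> * fps_l1 K f) ^ i / fact i)"
    by (simp add: power_mult_distrib)
  also have "\<dots> \<le> exp (\<bar>c\<bar> * fps_l1 K f)"
    unfolding exp_def scaleR_conv_of_real
    using summable_exp_generic[of "\<bar>c\<bar> * fps_l1 K f"] fps_l1_nonneg[of K f]
    by (intro order_trans[OF _ sum_le_suminf[of _ "{..K}"]]) (auto simp: field_simps)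
  finally show ?thesis .
qed

text \<open>In degree \<open>k\<close> the factors \<open>i + 1\<close> produced by the derivative are at most \<open>k + 1\<close>.\<close>

lemma weighted_l1_deriv_mult:
  "(\<Sum>k\<le>K. \<bar>(fps_deriv f * g) $ k\<bar> / (real k + 1)) \<le> fps_l1 (Suc K) f * fps_l1 K g"
proof -
  have "(\<Sum>k\<le>K. \<bar>(fps_deriv f * g) $ k\<bar> / (real k + 1))
      \<le> (\<Sum>k\<le>K. \<Sum>i\<le>k. \<bar>f $ Suc i\<bar> * \<bar>g $ (k - i)\<bar>)"
  proof (rule sum_mono)
    fix k
    have "\<bar>(fps_deriv f * g) $ k\<bar> / (real k + 1)
        \<le> (\<Sum>i\<le>k. (real i + 1) * \<bar>f $ Suc i\<bar> * \<bar>g $ (k - i)\<bar>) / (real k + 1)"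
      unfolding fps_mult_nth atLeast0AtMost
      by (intro divide_right_mono order_trans[OF sum_abs])
         (simp_all add: abs_mult abs_of_nonneg[of "1 + real _"] mult.assoc add.commute)
    also have "\<dots> = (\<Sum>i\<le>k. (real i + 1) / (real k + 1) * (\<bar>f $ Suc i\<bar> * \<bar>g $ (k - i)\<bar>))"
      by (simp add: sum_divide_distrib mult.assoc)
    also have "\<dots> \<le> (\<Sum>i\<le>k. \<bar>f $ Suc i\<bar> * \<bar>g $ (k - i)\<bar>)"
      by (intro sum_mono mult_left_le_one_le) auto
    finally show "\<bar>(fps_deriv f * g) $ k\<bar> / (real k + 1) \<le> (\<Sum>i\<le>k. \<bar>f $ Suc i\<bar> * \<bar>g $ (k - i)\<bar>)" .
  qed
  also have "\<dots> \<le> (\<Sum>i\<le>K. \<bar>f $ Suc i\<bar>) * fps_l1 K g"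
    unfolding fps_l1_def by (rule triangle_sum_le_product) auto
  also have "\<dots> \<le> fps_l1 (Suc K) f * fps_l1 K g"
    unfolding fps_l1_def sum.atMost_Suc_shift by (intro mult_right_mono) (auto simp: sum_nonneg)
  finally show ?thesis .
qed

subsection \<open>Compound Poisson laws and their Levy measures\<close>

text \<open>The intensity \<open>l\<close> is deliberately not tied to the total mass of
  \<open>v\<close>: the comparison lemmas pass through series such as
  \<open>cp_fps l (\<lambda>k. c * v k)\<close>, in which the weights shrink while the factor
  \<open>exp (- l)\<close> stays.\<close>

definition cp_fps :: "real \<Rightarrow> (nat \<Rightarrow> real) \<Rightarrow> real fps" where
  "cp_fps l v = fps_const (exp (- l)) * (fps_exp 1 oo Abs_fps v)"

lemma conv_power_eq: "conv_power p j k = (Abs_fps p ^ j) $ k"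
proof (induction j arbitrary: k)
  case (Suc j)
  then show ?case by (simp add: conv_def fps_mult_nth atLeast0AtMost)
qed simp

text \<open>Without jumps of size 0 the \<open>j\<close>-fold convolution vanishes below
  \<open>j\<close>, so the infinite series stops at \<open>j = k\<close>, like the composition of
  formal power series.\<close>

lemma compound_poisson_eq_cp_fps:
  assumes "p 0 = 0"
  shows "compound_poisson l p k = cp_fps l (levy l p) $ k"
proof -
  have zero: "(Abs_fps p ^ j) $ k = 0" if "k < j" for j
    using startsby_zero_power_prefix[of "Abs_fps p"] assms that by simp
  have pow: "(Abs_fps (levy l p) ^ j) $ k = l ^ j * (Abs_fps p ^ j) $ k" for j
  proof -
    have "Abs_fps (levy l p) = fps_const l * Abs_fps p"
      by (simp add: fps_eq_iff levy_def)
    then show ?thesis by (simp add: power_mult_distrib fps_const_power)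
  qed
  have "(\<Sum>j. l ^ j / fact j * conv_power p j k) = (\<Sum>j\<le>k. l ^ j / fact j * conv_power p j k)"
    by (rule suminf_finite) (auto simp: conv_power_eq zero)
  then show ?thesis
    by (simp add: compound_poisson_def cp_fps_def fps_compose_nth atLeast0AtMost pow conv_power_eq)
qed

lemma fps_power_nth_mono:
  fixes f g :: "real fps"
  assumes "\<And>k. 0 \<le> f $ k" "\<And>k. f $ k \<le> g $ k"
  shows "0 \<le> (f ^ j) $ k \<and> (f ^ j) $ k \<le> (g ^ j) $ k"
proof (induction j arbitrary: k)
  case (Suc j)
  have "0 \<le> (f ^ Suc j) $ k"
    using Suc assms by (auto simp: fps_mult_nth intro!: sum_nonneg)
  moreover have "(f ^ Suc j) $ k \<le> (g ^ Suc j) $ k"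
    using Suc assms by (auto simp: fps_mult_nth intro!: sum_mono mult_mono intro: order_trans)
  ultimately show ?case by blast
qed simp

lemma cp_fps_nonneg: "(\<And>k. 0 \<le> v k) \<Longrightarrow> 0 \<le> cp_fps l v $ k"
  using fps_power_nth_mono[of "Abs_fps v" "Abs_fps v"]
  by (auto simp: cp_fps_def fps_compose_nth intro!: mult_nonneg_nonneg sum_nonneg)

lemma cp_fps_le:
  assumes "\<And>k. 0 \<le> v k" "\<And>k. v k \<le> v' k"
  shows "cp_fps l v $ k \<le> exp (l' - l) * cp_fps l' v' $ k"
proof -
  have "(fps_exp 1 oo Abs_fps v) $ k \<le> (fps_exp 1 oo Abs_fps v') $ k"
    using fps_power_nth_mono[of "Abs_fps v" "Abs_fps v'"] assms
    by (auto simp: fps_compose_nth intro!: sum_mono divide_right_mono)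
  then show ?thesis
    by (simp add: cp_fps_def mult_exp_exp flip: mult.assoc)
qed

text \<open>The value \<open>k\<close> is the sum of at most \<open>k\<close> jumps.\<close>

lemma cp_fps_scale_le:
  assumes "\<And>k. 0 \<le> v k" "0 \<le> c" "c \<le> 1"
  shows "c ^ k * cp_fps l v $ k \<le> cp_fps l (\<lambda>k. c * v k) $ k"
proof -
  have pow: "(Abs_fps (\<lambda>k. c * v k) ^ j) $ k = c ^ j * (Abs_fps v ^ j) $ k" for j
  proof -
    have "Abs_fps (\<lambda>k. c * v k) = fps_const c * Abs_fps v"
      by (simp add: fps_eq_iff)
    then show ?thesis by (simp add: power_mult_distrib fps_const_power)
  qed
  have "c ^ k * (fps_exp 1 oo Abs_fps v) $ k \<le> (fps_exp 1 oo Abs_fps (\<lambda>k. c * v k)) $ k"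
    unfolding fps_compose_nth pow sum_distrib_left
    using fps_power_nth_mono[of "Abs_fps v" "Abs_fps v"] assms
    by (auto intro!: sum_mono divide_right_mono mult_right_mono power_decreasing)
  then show ?thesis
    by (simp add: cp_fps_def mult.left_commute)
qed

lemma cp_fps_ge:
  assumes "\<And>k. 0 \<le> v k" "0 \<le> c" "c \<le> 1" "\<And>k. c * v k \<le> v' k"
  shows "exp (l - l') * c ^ k * cp_fps l v $ k \<le> cp_fps l' v' $ k"
proof -
  have "c ^ k * cp_fps l v $ k \<le> cp_fps l (\<lambda>k. c * v k) $ k"
    using assms by (intro cp_fps_scale_le) auto
  also have "\<dots> \<le> exp (l' - l) * cp_fps l' v' $ k"
    using assms by (intro cp_fps_le) auto
  finally have "exp (l - l') * (c ^ k * cp_fps l v $ k)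
      \<le> exp (l - l') * (exp (l' - l) * cp_fps l' v' $ k)"
    by (intro mult_left_mono) auto
  then show ?thesis by (simp add: mult_exp_exp flip: mult.assoc)
qed

lemma fps_l1_cp_fps:
  assumes "fps_l1 K (Abs_fps v) \<le> l"
  shows "fps_l1 K (cp_fps l v) \<le> 1"
proof -
  have "fps_l1 K (cp_fps l v) \<le> exp (- l) * exp (fps_l1 K (Abs_fps v))"
    using fps_l1_exp_compose[of K 1 "Abs_fps v"]
    by (simp add: cp_fps_def fps_l1_const_mult)
  also have "\<dots> \<le> exp (- l) * exp l"
    using assms by simp
  finally show ?thesis by (simp add: mult_exp_exp)
qed

text \<open>The Panjer recursion in generating function form. It recovers the Levy measure from the
  law without a logarithm.\<close>

lemma fps_deriv_cp_fps:
  "v 0 = 0 \<Longrightarrow> fps_deriv (cp_fps l v) = fps_deriv (Abs_fps v) * cp_fps l v"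
  by (simp add: cp_fps_def fps_compose_deriv mult_ac)

lemma cp_fps_inverse:
  assumes "v 0 = 0"
  shows "cp_fps l v * (fps_const (exp l) * (fps_exp (- 1) oo Abs_fps v)) = 1"
proof -
  have "(fps_exp 1 oo Abs_fps v) * (fps_exp (- 1) oo Abs_fps v) = (fps_exp 1 * fps_exp (- 1)) oo Abs_fps v"
    using assms by (simp add: fps_compose_mult_distrib)
  also have "fps_exp 1 * fps_exp (- 1 :: real) = 1"
    using fps_exp_add_mult[of "1::real" "- 1"] by simp
  finally have *: "(fps_exp 1 oo Abs_fps v) * (fps_exp (- 1) oo Abs_fps v) = 1" by simp
  have "cp_fps l v * (fps_const (exp l) * (fps_exp (- 1) oo Abs_fps v))
      = (fps_const (exp (- l)) * fps_const (exp l)) * ((fps_exp 1 oo Abs_fps v) * (fps_exp (- 1) oo Abs_fps v))"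
    by (simp only: cp_fps_def mult_ac)
  also have "\<dots> = 1"
    unfolding * by (simp add: mult_exp_exp)
  finally show ?thesis .
qed

text \<open>With \<open>N\<close>, \<open>N\<^sub>0\<close> the generating functions of \<open>v\<close>, \<open>v\<^sub>0\<close>, with \<open>Q\<close>, \<open>Q\<^sub>0\<close> those of the laws and
  \<open>\<Delta> = Q - Q\<^sub>0\<close>, one has \<open>(N - N\<^sub>0)' = (\<Delta>' - N\<^sub>0' \<Delta>) Q\<inverse>\<close>; the norm of \<open>Q\<inverse>\<close> is controlled
  by that of \<open>Q\<^sub>0\<inverse>\<close> because \<open>Q\<inverse> = Q\<^sub>0\<inverse> - Q\<^sub>0\<inverse> \<Delta> Q\<inverse>\<close>. Hence the bound does not depend on
  the intensity \<open>l\<close>.\<close>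

lemma levy_l1_stability:
  assumes v: "v 0 = 0" and v0: "v0 0 = 0" and l0: "fps_l1 K (Abs_fps v0) \<le> l0"
    and small: "fps_l1 K (cp_fps l v - cp_fps l0 v0) \<le> exp (- 2 * l0) / 2"
  shows "(\<Sum>k\<le>K. \<bar>v k - v0 k\<bar>)
    \<le> 2 * (1 + l0) * exp (2 * l0) * fps_l1 K (cp_fps l v - cp_fps l0 v0)"
proof -
  define Q where "Q = cp_fps l v"
  define Q0 where "Q0 = cp_fps l0 v0"
  define R where "R = fps_const (exp l) * (fps_exp (- 1) oo Abs_fps v)"
  define R0 where "R0 = fps_const (exp l0) * (fps_exp (- 1) oo Abs_fps v0)"
  define N where "N = Abs_fps v"
  define N0 where "N0 = Abs_fps v0"
  define D where "D = Q - Q0"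
  have QR: "Q * R = 1" "Q0 * R0 = 1"
    unfolding Q_def R_def Q0_def R0_def using v v0 by (auto intro: cp_fps_inverse)
  have dQ: "fps_deriv Q = fps_deriv N * Q" "fps_deriv Q0 = fps_deriv N0 * Q0"
    unfolding Q_def Q0_def N_def N0_def using v v0 by (auto intro: fps_deriv_cp_fps)
  have nonneg_l0: "0 \<le> l0" using l0 fps_l1_nonneg order_trans by blast
  have "fps_l1 K R0 \<le> exp l0 * exp (fps_l1 K (Abs_fps v0))"
    using fps_l1_exp_compose[of K "- 1" "Abs_fps v0"] by (simp add: R0_def fps_l1_const_mult)
  also have "\<dots> \<le> exp l0 * exp l0" using l0 by simp
  finally have R0: "fps_l1 K R0 \<le> exp (2 * l0)" by (simp add: mult_exp_exp)
  have "R0 * D * R = R0 * (Q * R) - (Q0 * R0) * R" by (simp add: D_def algebra_simps)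
  then have Req: "R = R0 - R0 * D * R" by (simp add: QR)
  have "fps_l1 K (R0 * D) \<le> fps_l1 K R0 * fps_l1 K D" by (rule fps_l1_mult)
  also have "\<dots> \<le> exp (2 * l0) * (exp (- 2 * l0) / 2)"
    using R0 small by (intro mult_mono fps_l1_nonneg) (auto simp: D_def Q_def Q0_def)
  also have "\<dots> = 1 / 2" by (simp add: mult_exp_exp)
  finally have half: "fps_l1 K (R0 * D) \<le> 1 / 2" .
  \<comment> \<open>The threshold in the smallness assumption gives \<open>R0 * D\<close> norm at
    most 1/2, so half of the norm of \<open>R\<close> can be absorbed on the left.\<close>
  have "fps_l1 K R \<le> fps_l1 K R0 + fps_l1 K (R0 * D * R)"
    by (subst Req) (rule fps_l1_diff)
  also have "\<dots> \<le> exp (2 * l0) + 1 / 2 * fps_l1 K R"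
    using R0 half by (intro add_mono order_trans[OF fps_l1_mult[of K "R0 * D" R]] mult_right_mono fps_l1_nonneg)
  finally have R: "fps_l1 K R \<le> 2 * exp (2 * l0)" by simp
  have "(fps_deriv N - fps_deriv N0) * Q = fps_deriv D - fps_deriv N0 * D"
    unfolding D_def by (simp add: dQ algebra_simps)
  then have "(fps_deriv N - fps_deriv N0) * (Q * R) = (fps_deriv D - fps_deriv N0 * D) * R"
    by (simp flip: mult.assoc)
  then have eq: "fps_deriv (N - N0) = fps_deriv D * R - fps_deriv N0 * (D * R)"
    by (simp add: QR algebra_simps)
  show ?thesis
  proof (cases K)
    case 0
    then show ?thesis using v v0 nonneg_l0 fps_l1_nonneg by simp
  next
    case (Suc L)
    have RL: "fps_l1 L R \<le> fps_l1 K R" "fps_l1 L D \<le> fps_l1 K D"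
      using Suc by (auto intro!: fps_l1_mono)
    \<comment> \<open>The constant coefficients vanish, and the others are read off the derivative
      with the index shifted by one. This division is why the weighted norm of
      \<open>weighted_l1_deriv_mult\<close> appears.\<close>
    have "\<bar>v (Suc k) - v0 (Suc k)\<bar> = \<bar>fps_deriv (N - N0) $ k\<bar> / (real k + 1)" for k
    proof -
      have "fps_deriv (N - N0) $ k = (real k + 1) * (v (Suc k) - v0 (Suc k))"
        by (simp add: N_def N0_def algebra_simps)
      then show ?thesis by (simp only: abs_mult) simp
    qed
    then have "(\<Sum>k\<le>K. \<bar>v k - v0 k\<bar>) = (\<Sum>k\<le>L. \<bar>fps_deriv (N - N0) $ k\<bar> / (real k + 1))"
      unfolding Suc sum.atMost_Suc_shift by (simp add: v v0)
    also have "\<dots> \<le> (\<Sum>k\<le>L. \<bar>(fps_deriv D * R) $ k\<bar> / (real k + 1)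
        + \<bar>(fps_deriv N0 * (D * R)) $ k\<bar> / (real k + 1))"
      unfolding eq by (intro sum_mono) (simp add: add_divide_distrib[symmetric] divide_right_mono)
    also have "\<dots> \<le> fps_l1 K D * fps_l1 L R + fps_l1 K N0 * fps_l1 L (D * R)"
      unfolding sum.distrib Suc by (intro add_mono weighted_l1_deriv_mult)
    also have "\<dots> \<le> fps_l1 K D * fps_l1 K R + l0 * (fps_l1 K D * fps_l1 K R)"
      using RL l0 nonneg_l0
      by (intro add_mono mult_mono order_trans[OF fps_l1_mult] mult_nonneg_nonneg fps_l1_nonneg)
         (auto simp: N0_def)
    also have "\<dots> = (1 + l0) * fps_l1 K D * fps_l1 K R" by (simp add: algebra_simps)
    also have "\<dots> \<le> (1 + l0) * fps_l1 K D * (2 * exp (2 * l0))"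
      using R nonneg_l0 by (intro mult_left_mono) (auto simp: fps_l1_nonneg)
    finally show ?thesis by (simp only: D_def Q_def Q0_def mult_ac)
  qed
qed

text \<open>Comparing coefficients in \<open>Q' = N' Q\<close> and using that \<open>Q\<close> has
  mass at most 1 bounds the mean of the law by that of the Levy measure. This feeds the Markov bound
  for the sum of the data.\<close>

lemma cp_fps_first_moment:
  assumes "v 0 = 0" "\<And>k. 0 \<le> v k" "\<And>K. fps_l1 K (Abs_fps v) \<le> l"
    and "\<And>K. (\<Sum>k\<le>K. real k * v k) \<le> B"
  shows "(\<Sum>k\<le>K. real k * cp_fps l v $ k) \<le> B"
proof (cases K)
  case 0
  then show ?thesis using assms(4)[of 0] by simp
next
  case (Suc L)
  have pos: "0 \<le> cp_fps l v $ k" for k using assms by (intro cp_fps_nonneg) auto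
  have "(\<Sum>k\<le>K. real k * cp_fps l v $ k) = (\<Sum>k\<le>L. fps_deriv (cp_fps l v) $ k)"
    unfolding Suc sum.atMost_Suc_shift by simp
  also have "\<dots> = (\<Sum>k\<le>L. \<Sum>i\<le>k. real (Suc i) * v (Suc i) * cp_fps l v $ (k - i))"
    by (simp add: fps_deriv_cp_fps[of v] assms(1) fps_mult_nth atLeast0AtMost)
  also have "\<dots> \<le> (\<Sum>i\<le>L. real (Suc i) * v (Suc i)) * (\<Sum>i\<le>L. cp_fps l v $ i)"
    using assms(2) pos by (intro triangle_sum_le_product) auto
  also have "(\<Sum>i\<le>L. real (Suc i) * v (Suc i)) = (\<Sum>k\<le>Suc L. real k * v k)"
    unfolding sum.atMost_Suc_shift by simp
  also have "(\<Sum>i\<le>L. cp_fps l v $ i) = fps_l1 L (cp_fps l v)"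
    using pos by (simp add: fps_l1_def)
  also have "(\<Sum>k\<le>Suc L. real k * v k) * fps_l1 L (cp_fps l v) \<le> (\<Sum>k\<le>Suc L. real k * v k) * 1"
    using assms by (intro mult_left_mono fps_l1_cp_fps sum_nonneg) auto
  finally show ?thesis using assms(4)[of "Suc L"] by simp
qed

subsection \<open>The prior\<close>

declare One_nat_def [simp del]

text \<open>The factor of one Dirichlet coordinate, cut off outside the unit interval so that it is
  integrable over the whole line.\<close>

definition unit_powr :: "real \<Rightarrow> real \<Rightarrow> real" where
  "unit_powr r x = (if 0 < x \<and> x < 1 then x powr (r - 1) else 0)"

lemma unit_powr_nonneg: "0 \<le> unit_powr r x"
  by (simp add: unit_powr_def)

lemma unit_powr_measurable [measurable]: "unit_powr r \<in> borel_measurable borel"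
  unfolding unit_powr_def by measurable

lemma nn_integral_unit_powr_le:
  assumes "0 < r"
  shows "(\<integral>\<^sup>+x. ennreal (unit_powr r x) \<partial>lborel) \<le> ennreal (1 / r)"
proof -
  have "((\<lambda>x. x powr (r - 1)) has_integral (1 powr (r - 1 + 1) / (r - 1 + 1))) {0..1}"
    using assms by (intro has_integral_powr_from_0) auto
  then have "((\<lambda>x. x powr (r - 1)) has_integral (1 / r)) {0..1}" by simp
  then have eq: "(\<integral>\<^sup>+x. ennreal (x powr (r - 1)) * indicator {0..1} x \<partial>lborel) = ennreal (1 / r)"
    by (intro nn_integral_has_integral_lebesgue') auto
  have "(\<integral>\<^sup>+x. ennreal (unit_powr r x) \<partial>lborel)
      \<le> (\<integral>\<^sup>+x. ennreal (x powr (r - 1)) * indicator {0..1} x \<partial>lborel)"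
    by (intro nn_integral_mono) (auto simp: unit_powr_def indicator_def)
  then show ?thesis using eq by simp
qed

section \<open>The Dirichlet law: upper bound for its total mass\<close>

definition dirichlet_const :: "nat \<Rightarrow> (nat \<Rightarrow> real) \<Rightarrow> real" where
  "dirichlet_const m al = Gamma (\<Sum>i\<in>{1..m}. al i) / (\<Prod>i\<in>{1..m}. Gamma (al i))"

lemma dirichlet_const_pos:
  assumes "1 \<le> m" "\<And>i. i \<in> {1..m} \<Longrightarrow> 0 < al i"
  shows "0 < dirichlet_const m al"
  using assms unfolding dirichlet_const_def
  by (intro divide_pos_pos prod_pos Gamma_real_pos sum_pos) auto

lemma simplex_point_measurable [measurable]:
  "simplex_point m \<in> measurable (PiM {1..<m} (\<lambda>_. lborel)) (PiM UNIV (\<lambda>_. borel))"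
proof (rule measurable_PiM_single')
  fix k
  consider "k \<in> {1..<m}" | "k \<notin> {1..<m}" "k = m" | "k \<notin> {1..<m}" "k \<noteq> m" by blast
  then show "(\<lambda>x. simplex_point m x k) \<in> borel_measurable (PiM {1..<m} (\<lambda>_. lborel))"
  proof cases
    case 1
    then have "(\<lambda>x. x k) \<in> measurable (PiM {1..<m} (\<lambda>_. lborel)) borel"
      using measurable_component_singleton[of k "{1..<m}" "\<lambda>_. lborel :: real measure"] by simp
    then show ?thesis using 1 by (simp add: simplex_point_def)
  next
    case 2
    then show ?thesis unfolding simplex_point_def by simp
  next
    case 3
    then have "simplex_point m x k = 0" for x by (auto simp: simplex_point_def)
    then show ?thesis by simp
  qed
qed auto

lemma dirichlet_density_measurable [measurable]:
  "dirichlet_density m al \<in> borel_measurable (PiM {1..<m} (\<lambda>_. lborel))"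
  unfolding dirichlet_density_def by measurable

lemma sum_simplex_point: "1 \<le> m \<Longrightarrow> (\<Sum>k\<in>{1..m}. simplex_point m x k) = 1"
proof -
  assume "1 \<le> m"
  then have "{1..m} = insert m {1..<m}" by auto
  then show ?thesis by (simp add: simplex_point_def)
qed

lemma dirichlet_density_eq:
  assumes "1 \<le> m" "dirichlet_density m al x \<noteq> 0"
  shows "\<forall>k\<in>{1..m}. 0 < simplex_point m x k"
    and "dirichlet_density m al x
      = dirichlet_const m al * (\<Prod>k\<in>{1..m}. simplex_point m x k powr (al k - 1))"
proof -
  have *: "\<forall>i\<in>{1..<m}. 0 < x i" "(\<Sum>i\<in>{1..<m}. x i) < 1"
    using assms unfolding dirichlet_density_def by meson+
  then show "\<forall>k\<in>{1..m}. 0 < simplex_point m x k"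
    by (auto simp: simplex_point_def)
  have "{1..m} = insert m {1..<m}" using assms by auto
  then have "(\<Prod>k\<in>{1..m}. simplex_point m x k powr (al k - 1))
      = (\<Prod>i\<in>{1..<m}. x i powr (al i - 1)) * (1 - (\<Sum>i\<in>{1..<m}. x i)) powr (al m - 1)"
    by (simp add: simplex_point_def)
  then show "dirichlet_density m al x
      = dirichlet_const m al * (\<Prod>k\<in>{1..m}. simplex_point m x k powr (al k - 1))"
    using * by (simp add: dirichlet_density_def dirichlet_const_def)
qed

text \<open>Some coordinate of a point of the simplex is at least \<open>1 / m\<close>; dropping its factor leaves a
  function that integrates as a product.\<close>

lemma dirichlet_density_le:
  assumes m: "1 \<le> m" and al: "\<And>i. i \<in> {1..m} \<Longrightarrow> 0 < al i \<and> al i \<le> 1"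
  shows "dirichlet_density m al x \<le> dirichlet_const m al *
    (\<Sum>i\<in>{1..m}. real m * (\<Prod>k\<in>{1..m} - {i}. unit_powr (al k) (simplex_point m x k)))"
    (is "_ \<le> _ * ?S")
proof (cases "dirichlet_density m al x = 0")
  case True
  moreover have "0 \<le> ?S"
    by (intro sum_nonneg mult_nonneg_nonneg prod_nonneg) (auto simp: unit_powr_nonneg)
  ultimately show ?thesis using dirichlet_const_pos[of m al] m al by simp
next
  case False
  let ?y = "simplex_point m x"
  note * = dirichlet_density_eq[OF m False]
  obtain i where i: "i \<in> {1..m}" "1 / real m \<le> ?y i"
  proof (rule ccontr)
    assume "\<not> thesis"
    with that have "\<And>i. i \<in> {1..m} \<Longrightarrow> ?y i < 1 / real m" by force
    then have "(\<Sum>k\<in>{1..m}. ?y k) < (\<Sum>k\<in>{1..m}. 1 / real m)"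
      using m by (intro sum_strict_mono) auto
    then show False using m by (simp add: sum_simplex_point)
  qed
  \<comment> \<open>Coordinate \<open>i\<close> is positive and all coordinates add up to 1, so the
    others stay strictly inside the cut-off of \<open>unit_powr\<close>.\<close>
  have less1: "?y k < 1" if "k \<in> {1..m} - {i}" for k
  proof -
    have "?y k < (\<Sum>k\<in>{k, i}. ?y k)" using that i *(1) by auto
    also have "\<dots> \<le> (\<Sum>k\<in>{1..m}. ?y k)"
      using that i *(1) by (intro sum_mono2) (auto intro: less_imp_le)
    finally show ?thesis by (simp only: sum_simplex_point[OF m])
  qed
  \<comment> \<open>The exponent \<open>al i - 1\<close> lies in (-1, 0], so the factor of the large
    coordinate costs at most \<open>m\<close>.\<close>
  have "?y i powr (al i - 1) \<le> (1 / real m) powr (al i - 1)"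
    using i m al[OF i(1)] by (intro powr_mono2') auto
  also have "\<dots> \<le> (1 / real m) powr (- 1)"
    using i m al[OF i(1)] by (intro powr_mono') auto
  also have "\<dots> = real m" using m by (simp add: powr_minus_divide)
  finally have yi: "?y i powr (al i - 1) \<le> real m" .
  have "(\<Prod>k\<in>{1..m}. ?y k powr (al k - 1))
      = ?y i powr (al i - 1) * (\<Prod>k\<in>{1..m} - {i}. ?y k powr (al k - 1))"
    using i by (simp add: prod.remove)
  also have "(\<Prod>k\<in>{1..m} - {i}. ?y k powr (al k - 1)) = (\<Prod>k\<in>{1..m} - {i}. unit_powr (al k) (?y k))"
    using less1 *(1) by (intro prod.cong) (auto simp: unit_powr_def)
  also have "?y i powr (al i - 1) * (\<Prod>k\<in>{1..m} - {i}. unit_powr (al k) (?y k))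
      \<le> real m * (\<Prod>k\<in>{1..m} - {i}. unit_powr (al k) (?y k))"
    using yi by (intro mult_right_mono prod_nonneg) (auto simp: unit_powr_nonneg)
  also have "\<dots> \<le> ?S"
    using i by (intro member_le_sum[of i "{1..m}"
          "\<lambda>i. real m * (\<Prod>k\<in>{1..m} - {i}. unit_powr (al k) (?y k))"])
      (auto intro!: mult_nonneg_nonneg prod_nonneg simp: unit_powr_nonneg)
  finally show ?thesis
    using *(2) dirichlet_const_pos[of m al] m al by (auto intro!: mult_left_mono less_imp_le)
qed

lemma nn_integral_prod_unit_powr_le:
  fixes r :: "nat \<Rightarrow> real"
  assumes "finite I" "0 < s" "\<And>k. k \<in> I \<Longrightarrow> s \<le> r k"
  shows "(\<integral>\<^sup>+x. (\<Prod>k\<in>I. ennreal (unit_powr (r k) (x k))) \<partial>PiM I (\<lambda>_. lborel)) \<le> ennreal ((1 / s) ^ card I)"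
proof -
  interpret product_sigma_finite "\<lambda>_::nat. lborel :: real measure" ..
  have "(\<integral>\<^sup>+x. (\<Prod>k\<in>I. ennreal (unit_powr (r k) (x k))) \<partial>PiM I (\<lambda>_. lborel))
      = (\<Prod>k\<in>I. \<integral>\<^sup>+x. ennreal (unit_powr (r k) x) \<partial>lborel)"
    using assms by (intro product_nn_integral_prod) auto
  also have "\<dots> \<le> (\<Prod>k\<in>I. ennreal (1 / s))"
  proof (rule prod_mono_ennreal)
    fix k assume "k \<in> I"
    then have "(\<integral>\<^sup>+x. ennreal (unit_powr (r k) x) \<partial>lborel) \<le> ennreal (1 / r k)"
      using assms by (intro nn_integral_unit_powr_le) force
    also have "\<dots> \<le> ennreal (1 / s)"
      using assms \<open>k \<in> I\<close> by (intro ennreal_leI divide_left_mono) (auto intro!: mult_pos_pos intro: less_le_trans)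
    finally show "(\<integral>\<^sup>+x. ennreal (unit_powr (r k) x) \<partial>lborel) \<le> ennreal (1 / s)" .
  qed
  also have "\<dots> = ennreal ((1 / s) ^ card I)"
    using assms by (simp add: ennreal_power)
  finally show ?thesis .
qed

text \<open>With coordinate \<open>m\<close> dropped, only free variables remain and the integral
  factorises. With another coordinate \<open>i\<close> dropped, the variable \<open>x i\<close>
  survives only in the dependent coordinate \<open>m\<close>; integrating it out first turns that
  factor into a one-dimensional integral as well.\<close>

lemma nn_integral_simplex_point_le:
  fixes al :: "nat \<Rightarrow> real"
  assumes m: "1 \<le> m" and i: "i \<in> {1..m}" and s: "0 < s" "\<And>k. k \<in> {1..m} \<Longrightarrow> s \<le> al k"
  shows "(\<integral>\<^sup>+x. (\<Prod>k\<in>{1..m} - {i}. ennreal (unit_powr (al k) (simplex_point m x k)))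
    \<partial>PiM {1..<m} (\<lambda>_. lborel)) \<le> ennreal ((1 / s) ^ (m - 1))"
proof (cases "i = m")
  case True
  have "{1..m} - {i} = {1..<m}" using True by auto
  moreover have "(\<integral>\<^sup>+x. (\<Prod>k\<in>{1..<m}. ennreal (unit_powr (al k) (simplex_point m x k)))
      \<partial>PiM {1..<m} (\<lambda>_. lborel)) = (\<integral>\<^sup>+x. (\<Prod>k\<in>{1..<m}. ennreal (unit_powr (al k) (x k)))
      \<partial>PiM {1..<m} (\<lambda>_. lborel))"
    by (intro nn_integral_cong prod.cong) (auto simp: simplex_point_def)
  ultimately show ?thesis
    using nn_integral_prod_unit_powr_le[of "{1..<m}" s al] s by simp
next
  case False
  interpret product_sigma_finite "\<lambda>_::nat. lborel :: real measure" ..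
  define I where "I = {1..<m} - {i}"
  have I: "finite I" "i \<notin> I" "insert i I = {1..<m}" using i False by (auto simp: I_def)
  have dom: "{1..m} - {i} = insert m I" "m \<notin> I" using False m by (auto simp: I_def)
  have card: "Suc (card I) = m - 1"
    using I by (metis card_atLeastLessThan card_insert_disjoint)
  let ?f = "\<lambda>x. \<Prod>k\<in>{1..m} - {i}. ennreal (unit_powr (al k) (simplex_point m x k))"
  have meas: "?f \<in> borel_measurable (PiM {1..<m} (\<lambda>_. lborel))"
  proof (rule borel_measurable_prod_ennreal)
    fix k
    have "(\<lambda>x. simplex_point m x k) \<in> borel_measurable (PiM {1..<m} (\<lambda>_. lborel))"
      by (rule measurable_compose[OF simplex_point_measurable measurable_component_singleton]) simp
    then show "(\<lambda>x. ennreal (unit_powr (al k) (simplex_point m x k)))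
        \<in> borel_measurable (PiM {1..<m} (\<lambda>_. lborel))"
      by measurable
  qed
  have "integral\<^sup>N (PiM {1..<m} (\<lambda>_. lborel)) ?f
      = (\<integral>\<^sup>+x. (\<integral>\<^sup>+y. ?f (x(i := y)) \<partial>lborel) \<partial>PiM I (\<lambda>_. lborel))"
    using product_nn_integral_insert[of I i ?f] I meas by simp
  also have "\<dots> \<le> (\<integral>\<^sup>+x. ennreal (1 / s) * (\<Prod>k\<in>I. ennreal (unit_powr (al k) (x k))) \<partial>PiM I (\<lambda>_. lborel))"
  proof (rule nn_integral_mono)
    fix x :: "nat \<Rightarrow> real"
    define t where "t = 1 - (\<Sum>k\<in>I. x k)"
    have eq: "?f (x(i := y)) = ennreal (unit_powr (al m) (t - y)) * (\<Prod>k\<in>I. ennreal (unit_powr (al k) (x k)))" for y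
    proof -
      have "(\<Sum>k\<in>{1..<m}. (x(i := y)) k) = y + (\<Sum>k\<in>I. x k)"
        using I by (subst I(3)[symmetric], subst sum.insert) (auto intro!: sum.cong)
      then have "simplex_point m (x(i := y)) m = t - y"
        by (simp add: simplex_point_def t_def)
      moreover have "(\<Prod>k\<in>I. ennreal (unit_powr (al k) (simplex_point m (x(i := y)) k)))
          = (\<Prod>k\<in>I. ennreal (unit_powr (al k) (x k)))"
        using I by (intro prod.cong) (auto simp: simplex_point_def I_def)
      ultimately show ?thesis unfolding dom(1) using I dom(2) by simp
    qed
    \<comment> \<open>Reflection and translation preserve Lebesgue measure, so the bound is uniform
      in the remaining variables, which enter only through \<open>t\<close>.\<close>
    have "(\<integral>\<^sup>+y. ennreal (unit_powr (al m) (t - y)) \<partial>lborel) = (\<integral>\<^sup>+y. ennreal (unit_powr (al m) y) \<partial>lborel)"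
      using nn_integral_real_affine[of "\<lambda>y. ennreal (unit_powr (al m) y)" "- 1" t] by simp
    also have "\<dots> \<le> ennreal (1 / al m)"
      using s m by (intro nn_integral_unit_powr_le) (auto intro: less_le_trans)
    also have "\<dots> \<le> ennreal (1 / s)"
      using s m by (intro ennreal_leI divide_left_mono) (auto intro!: mult_pos_pos intro: less_le_trans)
    finally have "(\<integral>\<^sup>+y. ennreal (unit_powr (al m) (t - y)) \<partial>lborel) \<le> ennreal (1 / s)" .
    then show "(\<integral>\<^sup>+y. ?f (x(i := y)) \<partial>lborel) \<le> ennreal (1 / s) * (\<Prod>k\<in>I. ennreal (unit_powr (al k) (x k)))"
      unfolding eq by (subst nn_integral_multc) (auto intro: mult_right_mono)
  qed
  also have "\<dots> = ennreal (1 / s) * (\<integral>\<^sup>+x. (\<Prod>k\<in>I. ennreal (unit_powr (al k) (x k))) \<partial>PiM I (\<lambda>_. lborel))"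
    by (intro nn_integral_cmult) measurable
  also have "\<dots> \<le> ennreal (1 / s) * ennreal ((1 / s) ^ card I)"
    using s I by (intro mult_left_mono nn_integral_prod_unit_powr_le) (auto simp: I_def)
  also have "\<dots> = ennreal ((1 / s) ^ (m - 1))"
    using s unfolding card[symmetric] by (subst ennreal_mult[symmetric]) auto
  finally show ?thesis .
qed

lemma sets_dirichlet [simp, measurable_cong]: "sets (dirichlet m al) = sets (PiM UNIV (\<lambda>_. borel))"
  by (simp add: dirichlet_def)

lemma space_dirichlet [simp]: "space (dirichlet m al) = UNIV"
  by (simp add: dirichlet_def space_PiM)

lemma emeasure_dirichlet:
  assumes "A \<in> sets (PiM UNIV (\<lambda>_. borel))"
  shows "emeasure (dirichlet m al) A
    = (\<integral>\<^sup>+x. ennreal (dirichlet_density m al x) * indicator A (simplex_point m x) \<partial>PiM {1..<m} (\<lambda>_. lborel))"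
proof -
  let ?P = "PiM {1..<m} (\<lambda>_. lborel :: real measure)"
  have "emeasure (dirichlet m al) A
      = emeasure (density ?P (\<lambda>x. ennreal (dirichlet_density m al x))) (simplex_point m -` A \<inter> space ?P)"
    using assms unfolding dirichlet_def by (subst emeasure_distr) auto
  also have "\<dots> = (\<integral>\<^sup>+x. ennreal (dirichlet_density m al x) * indicator (simplex_point m -` A \<inter> space ?P) x \<partial>?P)"
    using assms by (intro emeasure_density measurable_sets[OF simplex_point_measurable]) auto
  also have "\<dots> = (\<integral>\<^sup>+x. ennreal (dirichlet_density m al x) * indicator A (simplex_point m x) \<partial>?P)"
    by (intro nn_integral_cong) (auto simp: indicator_def)
  finally show ?thesis .
qed

text \<open>One factor \<open>m\<close> comes from the dropped coordinate, the other from the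
  \<open>m\<close> choices of it. The factor \<open>dirichlet_const m al\<close> recurs in the lower
  bound for boxes and cancels in the posterior ratio.\<close>

lemma emeasure_dirichlet_UNIV_le:
  assumes m: "1 \<le> m" and s: "0 < s" and al: "\<And>i. i \<in> {1..m} \<Longrightarrow> s \<le> al i \<and> al i \<le> 1"
  shows "emeasure (dirichlet m al) UNIV \<le> ennreal (dirichlet_const m al * (real m ^ 2 * (1 / s) ^ (m - 1)))"
proof -
  let ?P = "PiM {1..<m} (\<lambda>_. lborel :: real measure)"
  let ?T = "\<lambda>i x. \<Prod>k\<in>{1..m} - {i}. ennreal (unit_powr (al k) (simplex_point m x k))"
  have al': "\<And>i. i \<in> {1..m} \<Longrightarrow> 0 < al i \<and> al i \<le> 1" using al s by force
  have c: "0 < dirichlet_const m al" using m al' by (intro dirichlet_const_pos) auto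
  have meas [measurable]: "?T i \<in> borel_measurable ?P" for i
  proof (rule borel_measurable_prod_ennreal)
    fix k
    have "(\<lambda>x. simplex_point m x k) \<in> borel_measurable ?P"
      by (rule measurable_compose[OF simplex_point_measurable measurable_component_singleton]) simp
    then show "(\<lambda>x. ennreal (unit_powr (al k) (simplex_point m x k))) \<in> borel_measurable ?P"
      by measurable
  qed
  have "emeasure (dirichlet m al) UNIV = (\<integral>\<^sup>+x. ennreal (dirichlet_density m al x) \<partial>?P)"
    using emeasure_dirichlet[of UNIV m al] sets.top[of "PiM UNIV (\<lambda>_::nat. borel :: real measure)"]
    by (simp add: space_PiM)
  also have "\<dots> \<le> (\<integral>\<^sup>+x. ennreal (dirichlet_const m al) * (\<Sum>i\<in>{1..m}. ennreal (real m) * ?T i x) \<partial>?P)"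
  proof (rule nn_integral_mono)
    fix x
    have "ennreal (dirichlet_density m al x) \<le> ennreal (dirichlet_const m al *
      (\<Sum>i\<in>{1..m}. real m * (\<Prod>k\<in>{1..m} - {i}. unit_powr (al k) (simplex_point m x k))))"
      using m al' by (intro ennreal_leI dirichlet_density_le) auto
    also have "\<dots> = ennreal (dirichlet_const m al) * (\<Sum>i\<in>{1..m}. ennreal (real m) * ?T i x)"
      using c by (simp add: ennreal_mult sum_nonneg prod_nonneg unit_powr_nonneg prod_ennreal
          mult_nonneg_nonneg flip: sum_ennreal)
    finally show "ennreal (dirichlet_density m al x)
      \<le> ennreal (dirichlet_const m al) * (\<Sum>i\<in>{1..m}. ennreal (real m) * ?T i x)" .
  qed
  also have "\<dots> = ennreal (dirichlet_const m al) * (\<Sum>i\<in>{1..m}. ennreal (real m) * integral\<^sup>N ?P (?T i))"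
    by (simp add: nn_integral_cmult nn_integral_sum)
  also have "\<dots> \<le> ennreal (dirichlet_const m al) * (\<Sum>i\<in>{1..m}. ennreal (real m) * ennreal ((1 / s) ^ (m - 1)))"
    using m al s by (intro mult_left_mono sum_mono nn_integral_simplex_point_le) auto
  also have "\<dots> = ennreal (dirichlet_const m al * (real m ^ 2 * (1 / s) ^ (m - 1)))"
    using c s by (simp add: ennreal_mult ennreal_of_nat_eq_real_of_nat power2_eq_square mult.assoc)
  finally show ?thesis .
qed

section \<open>The Dirichlet law: lower bound for the mass of a small box in the free
  coordinates\<close>

definition dirichlet_box :: "nat \<Rightarrow> (nat \<Rightarrow> real) \<Rightarrow> real \<Rightarrow> (nat \<Rightarrow> real) set" where
  "dirichlet_box m \<beta> d = {p. \<forall>k\<in>{1..<m}. \<beta> k < p k \<and> p k < \<beta> k + d}"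

lemma sets_dirichlet_box: "dirichlet_box m \<beta> d \<in> sets (PiM UNIV (\<lambda>_. borel))"
proof -
  have "{p \<in> space (PiM UNIV (\<lambda>_. borel)). \<forall>k\<in>{1..<m}. \<beta> k < p k \<and> p k < \<beta> k + d}
      \<in> sets (PiM UNIV (\<lambda>_. borel))"
    by measurable
  then show ?thesis by (simp add: dirichlet_box_def space_PiM)
qed

text \<open>As \<open>al i \<le> 1\<close>, every factor \<open>y powr (al i - 1)\<close> with
  \<open>0 < y \<le> 1\<close> is at least 1, so on the open simplex the density is at least its
  constant. The condition on the sum keeps the box, of volume \<open>d ^ (m - 1)\<close>, inside
  that simplex.\<close>

lemma emeasure_dirichlet_box_ge:
  assumes m: "1 \<le> m" and al: "\<And>i. i \<in> {1..m} \<Longrightarrow> 0 < al i \<and> al i \<le> 1"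
    and d: "0 < d" and \<beta>: "\<And>k. 0 \<le> \<beta> k" and sum: "(\<Sum>k\<in>{1..<m}. \<beta> k + d) < 1"
  shows "ennreal (dirichlet_const m al * d ^ (m - 1)) \<le> emeasure (dirichlet m al) (dirichlet_box m \<beta> d)"
proof -
  let ?P = "PiM {1..<m} (\<lambda>_. lborel :: real measure)"
  let ?B = "PiE {1..<m} (\<lambda>k. {\<beta> k<..<\<beta> k + d})"
  interpret product_sigma_finite "\<lambda>_::nat. lborel :: real measure" ..
  interpret finite_product_sigma_finite "\<lambda>_::nat. lborel :: real measure" "{1..<m}" by standard auto
  have c: "0 < dirichlet_const m al" using m al by (intro dirichlet_const_pos) auto
  have [measurable]: "?B \<in> sets ?P" by (intro sets_PiM_I_finite) auto
  have "emeasure ?P ?B = (\<Prod>k\<in>{1..<m}. emeasure lborel {\<beta> k<..<\<beta> k + d})"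
    by (intro emeasure_PiM) auto
  also have "\<dots> = ennreal (d ^ (m - 1))"
    using d by (simp add: ennreal_power)
  finally have vol: "emeasure ?P ?B = ennreal (d ^ (m - 1))" .
  have "ennreal (dirichlet_const m al * d ^ (m - 1)) = (\<integral>\<^sup>+x. ennreal (dirichlet_const m al) * indicator ?B x \<partial>?P)"
    using c d by (simp add: vol ennreal_mult nn_integral_cmult)
  also have "\<dots> \<le> (\<integral>\<^sup>+x. ennreal (dirichlet_density m al x)
      * indicator (dirichlet_box m \<beta> d) (simplex_point m x) \<partial>?P)"
  proof (rule nn_integral_mono)
    fix x
    show "ennreal (dirichlet_const m al) * indicator ?B x
      \<le> ennreal (dirichlet_density m al x) * indicator (dirichlet_box m \<beta> d) (simplex_point m x)"
    proof (cases "x \<in> ?B")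
      case True
      then have x: "\<beta> k < x k \<and> x k < \<beta> k + d" if "k \<in> {1..<m}" for k
        using that by (auto simp: PiE_iff)
      have pos: "0 < x k" if "k \<in> {1..<m}" for k using x[OF that] \<beta>[of k] by linarith
      have "(\<Sum>k\<in>{1..<m}. x k) \<le> (\<Sum>k\<in>{1..<m}. \<beta> k + d)"
        using x by (intro sum_mono) (auto intro: less_imp_le)
      then have less1: "(\<Sum>k\<in>{1..<m}. x k) < 1" using sum by simp
      have y: "0 < simplex_point m x k \<and> simplex_point m x k \<le> 1" if "k \<in> {1..m}" for k
      proof -
        have nonneg: "0 < simplex_point m x k" if "k \<in> {1..m}" for k
          using pos less1 that by (auto simp: simplex_point_def)
        then have "simplex_point m x k \<le> (\<Sum>k\<in>{1..m}. simplex_point m x k)"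
          using that by (intro member_le_sum) (auto intro: less_imp_le)
        then show ?thesis using that m nonneg by (simp only: sum_simplex_point[OF m])
      qed
      have "1 \<le> (\<Prod>k\<in>{1..m}. simplex_point m x k powr (al k - 1))"
      proof (rule prod_ge_1)
        fix k assume k: "k \<in> {1..m}"
        show "1 \<le> simplex_point m x k powr (al k - 1)"
          using powr_mono'[of "al k - 1" 0 "simplex_point m x k"] y[OF k] al[OF k] by simp
      qed
      moreover have "dirichlet_density m al x
          = dirichlet_const m al * (\<Prod>k\<in>{1..m}. simplex_point m x k powr (al k - 1))"
      proof -
        have "{1..m} = insert m {1..<m}" using m by auto
        then have "(\<Prod>k\<in>{1..m}. simplex_point m x k powr (al k - 1))
            = (\<Prod>i\<in>{1..<m}. x i powr (al i - 1)) * (1 - (\<Sum>i\<in>{1..<m}. x i)) powr (al m - 1)"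
          by (simp add: simplex_point_def)
        then show ?thesis
          using pos less1 by (simp add: dirichlet_density_def dirichlet_const_def)
      qed
      ultimately have "dirichlet_const m al \<le> dirichlet_density m al x"
        using c by simp
      moreover have "simplex_point m x \<in> dirichlet_box m \<beta> d"
        using x by (auto simp: dirichlet_box_def simplex_point_def)
      ultimately show ?thesis using True by (simp add: ennreal_leI)
    qed simp
  qed
  also have "\<dots> = emeasure (dirichlet m al) (dirichlet_box m \<beta> d)"
    using sets_dirichlet_box by (rule emeasure_dirichlet[symmetric])
  finally show ?thesis .
qed

definition simplex_pmf :: "nat \<Rightarrow> (nat \<Rightarrow> real) \<Rightarrow> bool" where
  "simplex_pmf m p \<longleftrightarrow> (\<forall>k. 0 \<le> p k) \<and> (\<forall>k. k \<notin> {1..m} \<longrightarrow> p k = 0) \<and> (\<Sum>k\<in>{1..m}. p k) = 1"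

lemma sets_simplex_pmf: "{p. simplex_pmf m p} \<in> sets (PiM UNIV (\<lambda>_. borel))"
proof -
  have "{p \<in> space (PiM UNIV (\<lambda>_. borel)). (\<forall>k. 0 \<le> p k) \<and> (\<forall>k. k \<notin> {1..m} \<longrightarrow> p k = 0)
      \<and> (\<Sum>k\<in>{1..m}. p k) = (1::real)} \<in> sets (PiM UNIV (\<lambda>_. borel))"
    by measurable
  then show ?thesis by (simp add: simplex_pmf_def space_PiM)
qed

lemma AE_dirichlet:
  assumes "1 \<le> m"
  shows "AE p in dirichlet m al. simplex_pmf m p"
proof -
  have "AE x in PiM {1..<m} (\<lambda>_. lborel). ennreal (dirichlet_density m al x) > 0
      \<longrightarrow> simplex_pmf m (simplex_point m x)"
  proof (intro AE_I2 impI)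
    fix x assume "0 < ennreal (dirichlet_density m al x)"
    then have "dirichlet_density m al x \<noteq> 0" by auto
    then have "\<forall>k\<in>{1..m}. 0 < simplex_point m x k" using assms by (intro dirichlet_density_eq)
    moreover have "simplex_point m x k = 0" if "k \<notin> {1..m}" for k
      using that assms by (auto simp: simplex_point_def)
    ultimately show "simplex_pmf m (simplex_point m x)"
      using sum_simplex_point[OF assms, of x] unfolding simplex_pmf_def
      by (metis less_imp_le order_refl)
  qed
  then show ?thesis
    using sets_simplex_pmf[of m] unfolding dirichlet_def
    by (subst AE_distr_iff) (auto simp: AE_density space_PiM)
qed

section \<open>The gamma law of the intensity: tail, total mass and mass of a short interval\<close>

definition gamma_const :: "real \<Rightarrow> real \<Rightarrow> real" where
  "gamma_const a b = b powr a / Gamma a"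

lemma gamma_const_pos: "0 < a \<Longrightarrow> 0 < b \<Longrightarrow> 0 < gamma_const a b"
  by (simp add: gamma_const_def Gamma_real_pos)

lemma sets_gamma_dist [simp, measurable_cong]: "sets (gamma_dist a b) = sets borel"
  by (simp add: gamma_dist_def)

lemma space_gamma_dist [simp]: "space (gamma_dist a b) = UNIV"
  by (simp add: gamma_dist_def)

lemma emeasure_gamma_dist:
  "A \<in> sets borel \<Longrightarrow> emeasure (gamma_dist a b) A = (\<integral>\<^sup>+x. ennreal (if 0 < x then
    gamma_const a b * x powr (a - 1) * exp (- b * x) else 0) * indicator A x \<partial>lborel)"
  unfolding gamma_dist_def gamma_const_def by (subst emeasure_density) auto

lemma AE_gamma_dist: "AE x in gamma_dist a b. 0 < x"
  unfolding gamma_dist_def by (subst AE_density) auto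

text \<open>Beyond 1 the factor \<open>y powr (a - 1)\<close> is at most 1 because
  \<open>a \<le> 1\<close>, which leaves a pure exponential.\<close>

lemma emeasure_gamma_dist_tail_le:
  assumes "0 < a" "a \<le> 1" "0 < b" "1 \<le> x"
  shows "emeasure (gamma_dist a b) {x<..} \<le> ennreal (gamma_const a b / b * exp (- b * x))"
proof -
  have c: "0 < gamma_const a b" using assms by (simp add: gamma_const_pos)
  have "emeasure (gamma_dist a b) {x<..}
      \<le> (\<integral>\<^sup>+y. ennreal (gamma_const a b * exp (- b * y)) * indicator {x..} y \<partial>lborel)"
    unfolding emeasure_gamma_dist[OF borel_open[OF open_greaterThan]]
  proof (rule nn_integral_mono)
    fix y
    show "ennreal (if 0 < y then gamma_const a b * y powr (a - 1) * exp (- b * y) else 0) * indicator {x<..} y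
        \<le> ennreal (gamma_const a b * exp (- b * y)) * indicator {x..} y"
    proof (cases "x < y")
      case True
      then have "y powr (a - 1) \<le> y powr 0" using assms by (intro powr_mono) auto
      then have "y powr (a - 1) \<le> 1" using True assms by simp
      then have "gamma_const a b * y powr (a - 1) * exp (- b * y) \<le> gamma_const a b * 1 * exp (- b * y)"
        using c by (intro mult_right_mono mult_left_mono) auto
      then show ?thesis using True assms by (simp add: ennreal_leI)
    qed simp
  qed
  also have "\<dots> = ennreal (0 - (- (gamma_const a b / b * exp (- b * x))))"
  proof (rule nn_integral_FTC_atLeast)
    show "((\<lambda>y. - (gamma_const a b / b * exp (- b * y))) \<longlongrightarrow> 0) at_top"
      using assms by real_asymp
    show "DERIV (\<lambda>y. - (gamma_const a b / b * exp (- b * y))) y :> gamma_const a b * exp (- b * y)" for y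
      using assms by (auto intro!: derivative_eq_intros)
  qed (use c in auto)
  finally show ?thesis by simp
qed

text \<open>Split at 1: below, the exponential is at most 1 and the power integrates to
  \<open>1 / a\<close>; above, the tail bound gives \<open>1 / b\<close>.\<close>

lemma emeasure_gamma_dist_UNIV_le:
  assumes "0 < a" "a \<le> 1" "0 < b"
  shows "emeasure (gamma_dist a b) UNIV \<le> ennreal (gamma_const a b * (1 / a + 1 / b))"
proof -
  have c: "0 < gamma_const a b" using assms by (simp add: gamma_const_pos)
  have "emeasure (gamma_dist a b) {..1}
      \<le> (\<integral>\<^sup>+y. ennreal (gamma_const a b) * (ennreal (y powr (a - 1)) * indicator {0..1} y) \<partial>lborel)"
    unfolding emeasure_gamma_dist[OF borel_closed[OF closed_atMost]]
  proof (rule nn_integral_mono)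
    fix y
    show "ennreal (if 0 < y then gamma_const a b * y powr (a - 1) * exp (- b * y) else 0) * indicator {..1} y
        \<le> ennreal (gamma_const a b) * (ennreal (y powr (a - 1)) * indicator {0..1} y)"
    proof (cases "0 < y \<and> y \<le> 1")
      case True
      have "gamma_const a b * y powr (a - 1) * exp (- b * y) \<le> gamma_const a b * y powr (a - 1) * 1"
        using c True assms by (intro mult_left_mono) auto
      then show ?thesis using True c by (simp add: ennreal_leI flip: ennreal_mult)
    qed auto
  qed
  also have "\<dots> = ennreal (gamma_const a b) * (\<integral>\<^sup>+y. ennreal (y powr (a - 1)) * indicator {0..1} y \<partial>lborel)"
    by (intro nn_integral_cmult) auto
  also have "(\<integral>\<^sup>+y. ennreal (y powr (a - 1)) * indicator {0..1} y \<partial>lborel) = ennreal (1 / a)"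
    using has_integral_powr_from_0[of "a - 1" 1] assms
    by (intro nn_integral_has_integral_lebesgue') auto
  finally have 1: "emeasure (gamma_dist a b) {..1} \<le> ennreal (gamma_const a b * (1 / a))"
    using c assms by (subst (asm) ennreal_mult[symmetric]) auto
  have "emeasure (gamma_dist a b) {1<..} \<le> ennreal (gamma_const a b / b * exp (- b * 1))"
    using assms by (intro emeasure_gamma_dist_tail_le) auto
  also have "\<dots> \<le> ennreal (gamma_const a b / b * 1)"
    using c assms by (intro ennreal_leI mult_left_mono) auto
  finally have 2: "emeasure (gamma_dist a b) {1<..} \<le> ennreal (gamma_const a b * (1 / b))" by simp
  have "emeasure (gamma_dist a b) ({..1} \<union> {1<..})
      \<le> emeasure (gamma_dist a b) {..1} + emeasure (gamma_dist a b) {1<..}"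
    by (intro emeasure_subadditive) auto
  also have "\<dots> \<le> ennreal (gamma_const a b * (1 / a)) + ennreal (gamma_const a b * (1 / b))"
    using 1 2 by (rule add_mono)
  also have "\<dots> = ennreal (gamma_const a b * (1 / a + 1 / b))"
    using c assms by (subst ennreal_plus[symmetric]) (auto simp: algebra_simps)
  also have "{..1} \<union> {1<..} = (UNIV :: real set)" by auto
  finally show ?thesis .
qed

text \<open>For \<open>a \<le> 1\<close> the density decreases, so its value at \<open>l + 1\<close>
  bounds it from below on the interval.\<close>

lemma emeasure_gamma_dist_ge:
  assumes "0 < a" "a \<le> 1" "0 < b" "0 < l" "0 < h" "h \<le> 1"
  shows "ennreal (gamma_const a b * (l + 1) powr (a - 1) * exp (- b * (l + 1)) * h)
    \<le> emeasure (gamma_dist a b) {l..l + h}"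
proof -
  let ?c = "gamma_const a b * (l + 1) powr (a - 1) * exp (- b * (l + 1))"
  have c: "0 < gamma_const a b" using assms by (simp add: gamma_const_pos)
  have "ennreal (?c * h) = (\<integral>\<^sup>+y. ennreal ?c * indicator {l..l + h} y \<partial>lborel)"
    using assms c by (simp add: nn_integral_cmult ennreal_mult)
  also have "\<dots> \<le> emeasure (gamma_dist a b) {l..l + h}"
    unfolding emeasure_gamma_dist[OF borel_closed[OF closed_atLeastAtMost]]
  proof (rule nn_integral_mono)
    fix y
    show "ennreal ?c * indicator {l..l + h} y
      \<le> ennreal (if 0 < y then gamma_const a b * y powr (a - 1) * exp (- b * y) else 0) * indicator {l..l + h} y"
    proof (cases "y \<in> {l..l + h}")
      case True
      then have "0 < y" "y \<le> l + 1" using assms by auto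
      moreover have "(l + 1) powr (a - 1) \<le> y powr (a - 1)"
        using assms \<open>0 < y\<close> \<open>y \<le> l + 1\<close> by (intro powr_mono2') auto
      ultimately have "?c \<le> gamma_const a b * y powr (a - 1) * exp (- b * y)"
        using c assms by (intro mult_mono) auto
      then show ?thesis using True \<open>0 < y\<close> by (simp add: ennreal_leI)
    qed simp
  qed
  finally show ?thesis .
qed

lemma prior_facts:
  assumes ab: "0 < a" "a \<le> 1" "0 < b"
    and m: "1 \<le> m" and s: "0 < s" "s \<le> 1" and al: "\<And>i. i \<in> {1..m} \<Longrightarrow> s \<le> al i \<and> al i \<le> 1"
  defines "W \<equiv> dirichlet_const m al * (real m ^ 2 * (1 / s) ^ m)"
  shows finite_measure_prior: "finite_measure (prior a b m al)"
    and AE_prior: "AE t in prior a b m al. 0 < fst t \<and> simplex_pmf m (snd t)"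
    and measure_prior_UNIV_le: "measure (prior a b m al) UNIV \<le> gamma_const a b * (1 / a + 1 / b) * W"
    and measure_prior_tail_le: "\<And>x. 1 \<le> x \<Longrightarrow> measure (prior a b m al) ({x<..} \<times> UNIV)
      \<le> gamma_const a b / b * exp (- b * x) * W"
    and measure_prior_box_ge: "\<And>l h d \<beta>. 0 < l \<Longrightarrow> 0 < h \<Longrightarrow> h \<le> 1 \<Longrightarrow> 0 < d \<Longrightarrow> (\<And>k. 0 \<le> \<beta> k) \<Longrightarrow>
      (\<Sum>k\<in>{1..<m}. \<beta> k + d) < 1 \<Longrightarrow>
      gamma_const a b * (l + 1) powr (a - 1) * exp (- b * (l + 1)) * h * (dirichlet_const m al * d ^ (m - 1))
      \<le> measure (prior a b m al) ({l..l + h} \<times> dirichlet_box m \<beta> d)"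
proof -
  have al': "\<And>i. i \<in> {1..m} \<Longrightarrow> 0 < al i \<and> al i \<le> 1" using al s by force
  have c: "0 < gamma_const a b" "0 < dirichlet_const m al"
    using m al' ab by (auto intro: dirichlet_const_pos gamma_const_pos)
  \<comment> \<open>Rounding the exponent up to \<open>m\<close> is affordable, since only the order
    of the exponent matters in the end, and it spares the subtraction in
    \<open>volume_ratio\<close>.\<close>
  have "(1 / s) ^ (m - 1) \<le> (1 / s) ^ m" using s by (intro power_increasing) auto
  then have "dirichlet_const m al * (real m ^ 2 * (1 / s) ^ (m - 1)) \<le> W"
    unfolding W_def using c by (intro mult_left_mono) auto
  then have dir: "emeasure (dirichlet m al) UNIV \<le> ennreal W"
    by (intro order_trans[OF emeasure_dirichlet_UNIV_le[OF m s(1) al]] ennreal_leI)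
  have W: "0 \<le> W" unfolding W_def using c s by simp
  interpret G: finite_measure "gamma_dist a b"
    using emeasure_gamma_dist_UNIV_le[OF ab] by (intro finite_measureI) (auto simp: top_unique)
  interpret D: finite_measure "dirichlet m al"
    using dir by (intro finite_measureI) (auto simp: top_unique)
  interpret pair_sigma_finite "gamma_dist a b" "dirichlet m al" ..
  have prod: "emeasure (prior a b m al) (A \<times> B) = emeasure (gamma_dist a b) A * emeasure (dirichlet m al) B"
    if "A \<in> sets borel" "B \<in> sets (PiM UNIV (\<lambda>_. borel))" for A B
    unfolding prior_def using that by (intro D.emeasure_pair_measure_Times) auto
  have UNIV_sets: "UNIV \<in> sets (PiM UNIV (\<lambda>_::nat. borel :: real measure))"
    using sets.top[of "PiM UNIV (\<lambda>_::nat. borel :: real measure)"] by (simp add: space_PiM)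
  have space: "space (prior a b m al) = UNIV \<times> UNIV"
    by (simp add: prior_def space_pair_measure)
  have total: "emeasure (prior a b m al) (UNIV \<times> UNIV) \<le> ennreal (gamma_const a b * (1 / a + 1 / b) * W)"
  proof -
    have "emeasure (prior a b m al) (UNIV \<times> UNIV)
        \<le> ennreal (gamma_const a b * (1 / a + 1 / b)) * ennreal W"
      unfolding prod[OF _ UNIV_sets, OF borel_open[OF open_UNIV]]
      using emeasure_gamma_dist_UNIV_le[OF ab] dir by (intro mult_mono) auto
    then show ?thesis using c ab W by (subst ennreal_mult) auto
  qed
  show "finite_measure (prior a b m al)"
    using total by (intro finite_measureI) (auto simp: space top_unique)
  then interpret P: finite_measure "prior a b m al" .
  show "measure (prior a b m al) UNIV \<le> gamma_const a b * (1 / a + 1 / b) * W"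
    using total c ab W by (simp add: P.emeasure_eq_measure)
  show "measure (prior a b m al) ({x<..} \<times> UNIV) \<le> gamma_const a b / b * exp (- b * x) * W"
    if "1 \<le> x" for x
  proof -
    have "emeasure (prior a b m al) ({x<..} \<times> UNIV)
        \<le> ennreal (gamma_const a b / b * exp (- b * x)) * ennreal W"
      unfolding prod[OF _ UNIV_sets, OF borel_open[OF open_greaterThan]]
      using emeasure_gamma_dist_tail_le[OF ab that] dir by (intro mult_mono) auto
    then have "emeasure (prior a b m al) ({x<..} \<times> UNIV)
        \<le> ennreal (gamma_const a b / b * exp (- b * x) * W)"
      using c ab W by (subst ennreal_mult) auto
    then show ?thesis using c ab W by (simp add: P.emeasure_eq_measure)
  qed
  show "gamma_const a b * (l + 1) powr (a - 1) * exp (- b * (l + 1)) * h * (dirichlet_const m al * d ^ (m - 1))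
      \<le> measure (prior a b m al) ({l..l + h} \<times> dirichlet_box m \<beta> d)"
    if lh: "0 < l" "0 < h" "h \<le> 1" and d: "0 < d" "\<And>k. 0 \<le> \<beta> k" "(\<Sum>k\<in>{1..<m}. \<beta> k + d) < 1" for l h d \<beta>
  proof -
    have "ennreal (gamma_const a b * (l + 1) powr (a - 1) * exp (- b * (l + 1)) * h)
        * ennreal (dirichlet_const m al * d ^ (m - 1))
        \<le> emeasure (prior a b m al) ({l..l + h} \<times> dirichlet_box m \<beta> d)"
      unfolding prod[OF borel_closed[OF closed_atLeastAtMost] sets_dirichlet_box]
      using ab lh d m al' by (intro mult_mono emeasure_gamma_dist_ge emeasure_dirichlet_box_ge) auto
    then show ?thesis
      using c d by (subst (asm) ennreal_mult[symmetric]) (auto simp: P.emeasure_eq_measure lh less_imp_le)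
  qed
  have meas: "{t \<in> space (gamma_dist a b \<Otimes>\<^sub>M dirichlet m al). 0 < fst t \<and> simplex_pmf m (snd t)}
      \<in> sets (gamma_dist a b \<Otimes>\<^sub>M dirichlet m al)"
  proof -
    have "{0<..} \<times> {p. simplex_pmf m p} \<in> sets (gamma_dist a b \<Otimes>\<^sub>M dirichlet m al)"
      using sets_simplex_pmf by (intro pair_measureI) auto
    also have "{0<..} \<times> {p. simplex_pmf m p}
        = {t \<in> space (gamma_dist a b \<Otimes>\<^sub>M dirichlet m al). 0 < fst t \<and> simplex_pmf m (snd t)}"
      by (auto simp: space_pair_measure)
    finally show ?thesis .
  qed
  show "AE t in prior a b m al. 0 < fst t \<and> simplex_pmf m (snd t)"
    unfolding prior_def
  proof (rule AE_pair_measure[OF meas])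
    show "AE x in gamma_dist a b. AE y in dirichlet m al. 0 < fst (x, y) \<and> simplex_pmf m (snd (x, y))"
      using AE_gamma_dist[of a b] by eventually_elim (use AE_dirichlet[OF m, of al] in auto)
  qed
qed

subsection \<open>Likelihood and posterior\<close>

text \<open>The upper corner of the cell of mesh \<open>h\<close> with index \<open>j\<close>.\<close>

definition grid_levy :: "real \<Rightarrow> nat \<Rightarrow> (nat \<Rightarrow> nat) \<Rightarrow> nat \<Rightarrow> real" where
  "grid_levy h m j k = (if k \<in> {1..m} then (real (j k) + 1) * h else 0)"

text \<open>The intensity is the mass of the corner itself, so that the coefficients sum to at most
  1, as the affinity bound requires.\<close>

definition grid_fps :: "real \<Rightarrow> nat \<Rightarrow> (nat \<Rightarrow> nat) \<Rightarrow> real fps" where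
  "grid_fps h m j = cp_fps (\<Sum>k\<in>{1..m}. grid_levy h m j k) (grid_levy h m j)"

lemma fps_l1_Abs_fps_le:
  assumes "\<And>k. 0 \<le> v k" "\<And>k. k \<notin> {1..m} \<Longrightarrow> v k = 0"
  shows "fps_l1 K (Abs_fps v) \<le> (\<Sum>k\<in>{1..m}. v k)"
proof -
  have "fps_l1 K (Abs_fps v) = (\<Sum>k\<in>{..K} \<inter> {1..m}. v k)"
    using assms by (simp add: fps_l1_def) (rule sum.mono_neutral_right, auto)
  also have "\<dots> \<le> (\<Sum>k\<in>{1..m}. v k)"
    using assms by (intro sum_mono2) auto
  finally show ?thesis .
qed

lemma grid_levy_nonneg: "0 \<le> h \<Longrightarrow> 0 \<le> grid_levy h m j k"
  by (simp add: grid_levy_def)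

lemma grid_fps_nonneg: "0 \<le> h \<Longrightarrow> 0 \<le> grid_fps h m j $ k"
  unfolding grid_fps_def by (intro cp_fps_nonneg grid_levy_nonneg)

lemma fps_l1_grid_fps: "0 \<le> h \<Longrightarrow> fps_l1 K (grid_fps h m j) \<le> 1"
  unfolding grid_fps_def
  by (intro fps_l1_cp_fps fps_l1_Abs_fps_le) (auto simp: grid_levy_nonneg, auto simp: grid_levy_def)

text \<open>Each weight \<open>l * p k\<close> is rounded up to the grid, which only increases the
  coefficients of the exponential; the mass grows by at most \<open>m * h\<close>, and this is the
  exponent that is lost.\<close>

lemma compound_poisson_le_grid:
  assumes h: "0 < h" and l: "0 < l" "l \<le> real G * h" and p: "simplex_pmf m p"
  obtains j where "j \<in> PiE {1..m} (\<lambda>_. {..G})"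
    "\<And>k. \<bar>grid_levy h m j k - levy l p k\<bar> \<le> (if k \<in> {1..m} then h else 0)"
    "\<And>z. compound_poisson l p z \<le> exp (real m * h) * grid_fps h m j $ z"
proof -
  define j where "j = (\<lambda>k\<in>{1..m}. nat \<lfloor>l * p k / h\<rfloor>)"
  have p': "0 \<le> p k" "k \<notin> {1..m} \<Longrightarrow> p k = 0" "(\<Sum>k\<in>{1..m}. p k) = 1" for k
    using p by (auto simp: simplex_pmf_def)
  have floor: "real (nat \<lfloor>l * p k / h\<rfloor>) * h \<le> l * p k \<and> l * p k \<le> (real (nat \<lfloor>l * p k / h\<rfloor>) + 1) * h" for k
  proof -
    have "0 \<le> l * p k / h" using l h p' by simp
    then have "real (nat \<lfloor>l * p k / h\<rfloor>) \<le> l * p k / h" "l * p k / h \<le> real (nat \<lfloor>l * p k / h\<rfloor>) + 1"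
      by linarith+
    then show ?thesis using h by (simp add: field_simps)
  qed
  have near: "levy l p k \<le> grid_levy h m j k
      \<and> grid_levy h m j k \<le> levy l p k + (if k \<in> {1..m} then h else 0)" for k
    using floor[of k] p'(2)[of k] by (auto simp: grid_levy_def levy_def j_def algebra_simps)
  show thesis
  proof
    have "nat \<lfloor>l * p k / h\<rfloor> \<le> G" if "k \<in> {1..m}" for k
    proof -
      have "p k \<le> (\<Sum>k\<in>{1..m}. p k)" using that p'(1) by (intro member_le_sum) auto
      then have "l * p k \<le> l * 1" using l p'(3) by (intro mult_left_mono) auto
      also have "\<dots> \<le> real G * h" using l by simp
      finally have "l * p k \<le> real G * h" .
      then have "l * p k / h \<le> real G" using h by (simp add: pos_divide_le_eq)
      then show ?thesis by linarith
    qed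
    then show "j \<in> PiE {1..m} (\<lambda>_. {..G})" by (auto simp: j_def)
    show "\<bar>grid_levy h m j k - levy l p k\<bar> \<le> (if k \<in> {1..m} then h else 0)" for k
      using near[of k] by auto
    fix z
    have "compound_poisson l p z = cp_fps l (levy l p) $ z"
      using p'(2)[of 0] by (intro compound_poisson_eq_cp_fps) auto
    also have "\<dots> \<le> exp ((\<Sum>k\<in>{1..m}. grid_levy h m j k) - l) * grid_fps h m j $ z"
      unfolding grid_fps_def using near l p' by (intro cp_fps_le) (auto simp: levy_def)
    also have "\<dots> \<le> exp (real m * h) * grid_fps h m j $ z"
    proof (intro mult_right_mono)
      have "(\<Sum>k\<in>{1..m}. grid_levy h m j k) \<le> (\<Sum>k\<in>{1..m}. levy l p k + h)"
        using near by (intro sum_mono) (metis (mono_tags))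
      also have "\<dots> = l * (\<Sum>k\<in>{1..m}. p k) + real m * h"
        by (simp add: sum.distrib levy_def sum_distrib_left)
      finally show "exp ((\<Sum>k\<in>{1..m}. grid_levy h m j k) - l) \<le> exp (real m * h)"
        using p'(3) by simp
    qed (use h in \<open>simp add: grid_fps_nonneg\<close>)
    finally show "compound_poisson l p z \<le> exp (real m * h) * grid_fps h m j $ z" .
  qed
qed

text \<open>Makes the likelihood at most 1, so that the part of the prior beyond the grid
  contributes at most its mass.\<close>

lemma compound_poisson_bounds:
  assumes "0 \<le> l" "simplex_pmf m p"
  shows "0 \<le> compound_poisson l p z" "compound_poisson l p z \<le> 1"
proof -
  have p: "0 \<le> p k" "k \<notin> {1..m} \<Longrightarrow> p k = 0" "(\<Sum>k\<in>{1..m}. p k) = 1" for k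
    using assms by (auto simp: simplex_pmf_def)
  have eq: "compound_poisson l p z = cp_fps l (levy l p) $ z"
    using p(2)[of 0] by (intro compound_poisson_eq_cp_fps) auto
  show pos: "0 \<le> compound_poisson l p z"
    unfolding eq using p assms by (intro cp_fps_nonneg) (auto simp: levy_def)
  have "fps_l1 z (Abs_fps (levy l p)) \<le> (\<Sum>k\<in>{1..m}. levy l p k)"
    using p assms by (intro fps_l1_Abs_fps_le) (auto simp: levy_def)
  also have "\<dots> = l" using p(3) by (simp add: levy_def flip: sum_distrib_left)
  finally have "fps_l1 z (cp_fps l (levy l p)) \<le> 1" by (rule fps_l1_cp_fps)
  moreover have "\<bar>cp_fps l (levy l p) $ z\<bar> \<le> fps_l1 z (cp_fps l (levy l p))"
    unfolding fps_l1_def by (rule member_le_sum) auto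
  ultimately show "compound_poisson l p z \<le> 1" unfolding eq by linarith
qed

text \<open>In the box and for \<open>l0 \<le> l\<close> the Levy measure is at least
  \<open>1 - \<delta>\<close> times the true one; an observation \<open>z i\<close> then costs at
  most \<open>exp (- \<eta>) * (1 - \<delta>) ^ z i\<close>, and the powers collect into the sum of
  the data. Since the box leaves coordinate \<open>m\<close> free, the truth has to live strictly
  below \<open>m\<close>.\<close>

lemma likelihood_ge_box:
  assumes p: "simplex_pmf m p" and l0: "0 < l0" "l0 \<le> l" "l \<le> l0 + \<eta>"
    and box: "p \<in> dirichlet_box m (\<lambda>k. (1 - \<delta>) * p0 k) d" and \<delta>: "0 \<le> \<delta>" "\<delta> \<le> 1"
    and p0: "\<And>k. 0 \<le> p0 k" "p0 0 = 0" "\<And>k. m \<le> k \<Longrightarrow> p0 k = 0"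
    and z: "(\<Sum>i\<in>{1..n}. z i) \<le> S"
  shows "exp (- real n * \<eta>) * (1 - \<delta>) ^ S * (\<Prod>i\<in>{1..n}. compound_poisson l0 p0 (z i))
    \<le> likelihood n z (l, p)"
proof -
  have p': "0 \<le> p k" "k \<notin> {1..m} \<Longrightarrow> p k = 0" for k
    using p by (auto simp: simplex_pmf_def)
  have pos0: "0 \<le> compound_poisson l0 p0 k" for k
    unfolding compound_poisson_eq_cp_fps[of p0, OF p0(2)]
    using p0 l0 by (intro cp_fps_nonneg) (auto simp: levy_def)
  have step: "exp (- \<eta>) * (1 - \<delta>) ^ k * compound_poisson l0 p0 k \<le> compound_poisson l p k" for k
  proof -
    have "(1 - \<delta>) * levy l0 p0 k \<le> levy l p k" for k
    proof (cases "k \<in> {1..<m}")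
      case True
      then have "(1 - \<delta>) * p0 k \<le> p k" using box by (auto simp: dirichlet_box_def intro: less_imp_le)
      then have "l0 * ((1 - \<delta>) * p0 k) \<le> l * p k"
        using l0 \<delta> p0 by (intro mult_mono) auto
      then show ?thesis by (simp add: levy_def mult_ac)
    next
      case False
      then have "k = 0 \<or> m \<le> k" by auto
      then have "p0 k = 0" using p0(2,3) by auto
      then show ?thesis using l0 p'(1)[of k] by (simp add: levy_def)
    qed
    then have "exp (l0 - l) * (1 - \<delta>) ^ k * cp_fps l0 (levy l0 p0) $ k \<le> cp_fps l (levy l p) $ k"
      using p0 l0 \<delta> by (intro cp_fps_ge) (auto simp: levy_def)
    moreover have "exp (- \<eta>) * (1 - \<delta>) ^ k * compound_poisson l0 p0 k
        \<le> exp (l0 - l) * (1 - \<delta>) ^ k * compound_poisson l0 p0 k"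
      using pos0 \<delta> l0 by (intro mult_right_mono) auto
    ultimately show ?thesis
      using p'(2)[of 0] p0(2) by (simp add: compound_poisson_eq_cp_fps)
  qed
  have prod0: "0 \<le> (\<Prod>i\<in>{1..n}. compound_poisson l0 p0 (z i))" using pos0 by (intro prod_nonneg) auto
  have "exp (- real n * \<eta>) * (1 - \<delta>) ^ S * (\<Prod>i\<in>{1..n}. compound_poisson l0 p0 (z i))
      \<le> exp (- real n * \<eta>) * (1 - \<delta>) ^ (\<Sum>i\<in>{1..n}. z i) * (\<Prod>i\<in>{1..n}. compound_poisson l0 p0 (z i))"
    using z \<delta> prod0 by (intro mult_right_mono mult_left_mono power_decreasing) auto
  also have "\<dots> = (\<Prod>i\<in>{1..n}. exp (- \<eta>) * (1 - \<delta>) ^ z i * compound_poisson l0 p0 (z i))"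
    by (simp add: prod.distrib power_sum exp_of_nat_mult[symmetric])
  also have "\<dots> \<le> (\<Prod>i\<in>{1..n}. compound_poisson l p (z i))"
    using step pos0 \<delta> by (intro prod_mono) auto
  finally show ?thesis by (simp add: likelihood_def)
qed

text \<open>A likelihood that is not integrable makes the denominator, hence the posterior, zero, so that its
  measurability is not an issue.\<close>

lemma posterior_bounds:
  assumes fin: "finite_measure P"
    and L: "AE t in P. 0 \<le> likelihood n z t \<and> likelihood n z t \<le> 1"
    and num: "AE t in P. t \<in> A \<longrightarrow> t \<notin> T \<longrightarrow> likelihood n z t \<le> N" and T: "T \<in> sets P" and N: "0 \<le> N"
    and den: "AE t in P. t \<in> B \<longrightarrow> D \<le> likelihood n z t" and B: "B \<in> sets P"
    and pos: "0 < D" "0 < measure P B"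
  shows "\<bar>posterior P n z A\<bar> \<le> (N * measure P (space P) + measure P T) / (D * measure P B)"
proof (cases "integrable P (likelihood n z)")
  case False
  then have "posterior P n z A = 0"
    by (simp add: posterior_def not_integrable_integral_eq)
  then show ?thesis using N pos by simp
next
  case True
  interpret finite_measure P by fact
  have "D * measure P B = (LINT t|P. D * indicator B t)" using B by simp
  also have "\<dots> \<le> (LINT t|P. likelihood n z t)"
  proof (rule integral_mono_AE[OF _ True])
    show "integrable P (\<lambda>t. D * indicator B t)" using B by (auto simp: less_top[symmetric])
    show "AE t in P. D * indicator B t \<le> likelihood n z t"
      using L den by eventually_elim (auto simp: indicator_def)
  qed
  finally have D: "D * measure P B \<le> (LINT t|P. likelihood n z t)" .
  have nonneg: "0 \<le> (LINT t:A|P. likelihood n z t)"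
    unfolding set_lebesgue_integral_def using L by (intro integral_nonneg_AE) (auto simp: indicator_def)
  have "(LINT t:A|P. likelihood n z t) \<le> N * measure P (space P) + measure P T"
  \<comment> \<open>If the likelihood restricted to \<open>A\<close> is not integrable, its integral
    has the default value 0, which satisfies the bound.\<close>
  proof (cases "integrable P (\<lambda>t. indicator A t *\<^sub>R likelihood n z t)")
    case False
    then show ?thesis using N by (simp add: set_lebesgue_integral_def not_integrable_integral_eq)
  next
    case int: True
    have "(LINT t:A|P. likelihood n z t) \<le> (LINT t|P. N + indicator T t)"
      unfolding set_lebesgue_integral_def
    proof (rule integral_mono_AE[OF int])
      show "integrable P (\<lambda>t. N + indicator T t)" using T by (auto simp: less_top[symmetric])
      show "AE t in P. indicator A t *\<^sub>R likelihood n z t \<le> N + indicator T t"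
        using L num by eventually_elim (use N in \<open>auto simp: indicator_def\<close>)
    qed
    also have "\<dots> = N * measure P (space P) + measure P T"
      using T by (subst Bochner_Integration.integral_add) (auto simp: less_top[symmetric])
    finally show ?thesis .
  qed
  then have "posterior P n z A \<le> (N * measure P (space P) + measure P T) / (D * measure P B)"
    unfolding posterior_def using D pos nonneg by (intro frac_le) auto
  moreover have "0 \<le> posterior P n z A"
    unfolding posterior_def using D pos nonneg by (intro divide_nonneg_nonneg) (auto intro: order_trans[rotated])
  ultimately show ?thesis by simp
qed

subsection \<open>Probabilities of atypical samples\<close>

lemma sum_sqrt_mult_le:
  fixes u q :: "nat \<Rightarrow> real"
  assumes "finite A" "\<And>k. 0 \<le> u k" "\<And>k. 0 \<le> q k" "(\<Sum>k\<in>A. u k) \<le> 1" "(\<Sum>k\<in>A. q k) \<le> 1"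
  shows "(\<Sum>k\<in>A. sqrt (u k * q k)) \<le> 1 - (\<Sum>k\<in>A. \<bar>u k - q k\<bar>)\<^sup>2 / 8"
proof -
  define r where "r = (\<Sum>k\<in>A. sqrt (u k * q k))"
  have minus: "(\<Sum>k\<in>A. (sqrt (u k) - sqrt (q k))\<^sup>2) \<le> 2 - 2 * r"
  proof -
    have "(\<Sum>k\<in>A. (sqrt (u k) - sqrt (q k))\<^sup>2) = (\<Sum>k\<in>A. u k) + (\<Sum>k\<in>A. q k) - 2 * r"
      by (simp add: r_def power2_diff assms sum.distrib sum_subtractf real_sqrt_mult
          sum_distrib_left mult.assoc)
    then show ?thesis using assms by simp
  qed
  have plus: "(\<Sum>k\<in>A. (sqrt (u k) + sqrt (q k))\<^sup>2) \<le> 4"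
  proof -
    have "(sqrt (u k) + sqrt (q k))\<^sup>2 \<le> 2 * u k + 2 * q k" for k
      using sum_squares_bound[of "sqrt (u k)" "sqrt (q k)"] assms(2,3)[of k]
      by (simp add: power2_sum)
    then have "(\<Sum>k\<in>A. (sqrt (u k) + sqrt (q k))\<^sup>2) \<le> (\<Sum>k\<in>A. 2 * u k + 2 * q k)"
      by (intro sum_mono)
    also have "\<dots> = 2 * (\<Sum>k\<in>A. u k) + 2 * (\<Sum>k\<in>A. q k)"
      by (simp add: sum.distrib sum_distrib_left)
    finally show ?thesis using assms by simp
  qed
  have "(\<Sum>k\<in>A. \<bar>u k - q k\<bar>)\<^sup>2
      = (\<Sum>k\<in>A. \<bar>sqrt (u k) - sqrt (q k)\<bar> * (sqrt (u k) + sqrt (q k)))\<^sup>2"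
  proof -
    have "\<bar>u k - q k\<bar> = \<bar>sqrt (u k) - sqrt (q k)\<bar> * (sqrt (u k) + sqrt (q k))" for k
    proof -
      have "u k - q k = (sqrt (u k) - sqrt (q k)) * (sqrt (u k) + sqrt (q k))"
        using assms(2,3)[of k] by (simp add: algebra_simps)
      then have "\<bar>u k - q k\<bar> = \<bar>sqrt (u k) - sqrt (q k)\<bar> * \<bar>sqrt (u k) + sqrt (q k)\<bar>"
        by (simp only: abs_mult)
      then show ?thesis using assms(2,3)[of k] by simp
    qed
    then show ?thesis by simp
  qed
  also have "\<dots> \<le> (\<Sum>k\<in>A. \<bar>sqrt (u k) - sqrt (q k)\<bar>\<^sup>2) * (\<Sum>k\<in>A. (sqrt (u k) + sqrt (q k))\<^sup>2)"
    by (rule Cauchy_Schwarz_ineq_sum)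
  also have "\<dots> \<le> (2 - 2 * r) * 4"
  proof (intro mult_mono sum_nonneg plus)
    show "(\<Sum>k\<in>A. \<bar>sqrt (u k) - sqrt (q k)\<bar>\<^sup>2) \<le> 2 - 2 * r" using minus by simp
    then show "0 \<le> 2 - 2 * r" by (rule order_trans[rotated]) (simp add: sum_nonneg)
  qed simp
  finally show ?thesis unfolding r_def by simp
qed

text \<open>Under the law \<open>q\<close> the expected root of the ratio is the affinity of
  \<open>u\<close> and \<open>q\<close>. Distance found among the values up to \<open>K0\<close>
  suffices, since longer partial sums only increase it.\<close>

lemma (in prob_space) nn_integral_sqrt_ratio_le:
  fixes u q :: "nat \<Rightarrow> real"
  assumes X: "distributed M (count_space UNIV) X (\<lambda>k. ennreal (q k))"
    and nonneg: "\<And>k. 0 \<le> u k" "\<And>k. 0 \<le> q k" and le1: "\<And>K. (\<Sum>k\<le>K. u k) \<le> 1" "\<And>K. (\<Sum>k\<le>K. q k) \<le> 1"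
    and s: "0 \<le> s" "s \<le> (\<Sum>k\<le>K0. \<bar>u k - q k\<bar>)"
  shows "(\<integral>\<^sup>+w. ennreal (sqrt (u (X w) / q (X w))) \<partial>M) \<le> ennreal (exp (- s\<^sup>2 / 8))"
proof -
  have "(\<integral>\<^sup>+w. ennreal (sqrt (u (X w) / q (X w))) \<partial>M)
      = (\<integral>\<^sup>+k. ennreal (q k) * ennreal (sqrt (u k / q k)) \<partial>count_space UNIV)"
    by (rule distributed_nn_integral[OF X, symmetric]) simp
  also have "\<dots> = (\<integral>\<^sup>+k. ennreal (sqrt (u k * q k)) \<partial>count_space UNIV)"
  proof (rule nn_integral_cong)
    fix k
    \<comment> \<open>Where \<open>q k = 0\<close> both sides are 0.\<close>
    have "q k * sqrt (u k / q k) = sqrt (u k * q k)"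
      using nonneg[of k] by (cases "q k = 0")
        (auto simp: real_sqrt_divide real_sqrt_mult field_simps simp flip: power2_eq_square)
    then show "ennreal (q k) * ennreal (sqrt (u k / q k)) = ennreal (sqrt (u k * q k))"
      using nonneg[of k] by (simp flip: ennreal_mult)
  qed
  also have "\<dots> = (\<Sum>k. ennreal (sqrt (u k * q k)))"
    by (rule nn_integral_count_space_nat)
  also have "\<dots> \<le> ennreal (exp (- s\<^sup>2 / 8))"
  proof (rule suminf_le_const)
    fix K :: nat
    define L where "L = max K K0"
    have "(\<Sum>k<K. sqrt (u k * q k)) \<le> (\<Sum>k\<le>L. sqrt (u k * q k))"
      using nonneg by (intro sum_mono2) (auto simp: L_def)
    also have "\<dots> \<le> 1 - (\<Sum>k\<le>L. \<bar>u k - q k\<bar>)\<^sup>2 / 8"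
      using nonneg le1 by (intro sum_sqrt_mult_le) auto
    also have "\<dots> \<le> 1 - s\<^sup>2 / 8"
    proof -
      have "s \<le> (\<Sum>k\<le>L. \<bar>u k - q k\<bar>)"
        using s(2) by (rule order_trans) (auto intro!: sum_mono2 simp: L_def)
      then have "s\<^sup>2 \<le> (\<Sum>k\<le>L. \<bar>u k - q k\<bar>)\<^sup>2" using s by (intro power_mono) auto
      then show ?thesis by simp
    qed
    also have "\<dots> \<le> exp (- s\<^sup>2 / 8)" using exp_ge_add_one_self[of "- s\<^sup>2 / 8"] by simp
    finally have "(\<Sum>k<K. sqrt (u k * q k)) \<le> exp (- s\<^sup>2 / 8)" .
    then show "(\<Sum>k<K. ennreal (sqrt (u k * q k))) \<le> ennreal (exp (- s\<^sup>2 / 8))"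
      using nonneg by (simp add: ennreal_leI)
  qed auto
  finally show ?thesis .
qed

lemma (in prob_space) prob_ge_le:
  assumes "f \<in> borel_measurable M" "(\<integral>\<^sup>+w. ennreal (f w) \<partial>M) \<le> ennreal B" "0 < t" "0 \<le> B"
  shows "prob {w \<in> space M. t \<le> f w} \<le> B / t"
proof -
  have "emeasure M {w \<in> space M. t \<le> f w} = emeasure M {w \<in> space M. 1 \<le> ennreal (1 / t) * ennreal (f w)}"
  proof (rule arg_cong[where f="emeasure M"], intro set_eqI iffI)
    fix w assume w: "w \<in> {w \<in> space M. t \<le> f w}"
    then have "1 \<le> 1 / t * f w" using assms by (simp add: field_simps)
    then have "ennreal 1 \<le> ennreal (1 / t * f w)" by (rule ennreal_leI)
    moreover have "ennreal (1 / t * f w) = ennreal (1 / t) * ennreal (f w)"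
      using assms w by (intro ennreal_mult) auto
    ultimately have "1 \<le> ennreal (1 / t) * ennreal (f w)" by (simp only: ennreal_1)
    then show "w \<in> {w \<in> space M. 1 \<le> ennreal (1 / t) * ennreal (f w)}" using w by auto
  next
    fix w assume w: "w \<in> {w \<in> space M. 1 \<le> ennreal (1 / t) * ennreal (f w)}"
    have "0 < f w"
    proof (rule ccontr)
      assume "\<not> 0 < f w"
      then have "ennreal (f w) = 0" by (simp add: ennreal_neg)
      then show False using w by simp
    qed
    then have "ennreal (1 / t * f w) = ennreal (1 / t) * ennreal (f w)"
      using assms by (intro ennreal_mult) auto
    then have "ennreal 1 \<le> ennreal (1 / t * f w)" using w by (simp only: ennreal_1) auto
    then have "1 \<le> 1 / t * f w" using \<open>0 < f w\<close> assms by (subst (asm) ennreal_le_iff) auto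
    then show "w \<in> {w \<in> space M. t \<le> f w}" using w assms by (simp add: field_simps)
  qed
  also have "\<dots> \<le> ennreal (1 / t) * (\<integral>\<^sup>+w. ennreal (f w) * indicator (space M) w \<partial>M)"
    using assms by (intro nn_integral_Markov_inequality) auto
  also have "(\<integral>\<^sup>+w. ennreal (f w) * indicator (space M) w \<partial>M) = (\<integral>\<^sup>+w. ennreal (f w) \<partial>M)"
    by (intro nn_integral_cong) auto
  also have "ennreal (1 / t) * (\<integral>\<^sup>+w. ennreal (f w) \<partial>M) \<le> ennreal (1 / t) * ennreal B"
    using assms by (intro mult_left_mono) auto
  also have "\<dots> = ennreal (B / t)" using assms by (simp flip: ennreal_mult)
  finally show ?thesis using assms by (simp add: emeasure_eq_measure)
qed

text \<open>Independence turns the expected product into a power of the affinity; the rest is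
  Markov's inequality.\<close>

lemma (in prob_space) prob_prod_sqrt_ratio_ge:
  fixes u q :: "nat \<Rightarrow> real"
  assumes Z: "\<And>i. i \<in> {1..n} \<Longrightarrow> distributed M (count_space UNIV) (Z i) (\<lambda>k. ennreal (q k))"
    and indep: "indep_vars (\<lambda>_. count_space UNIV) Z {1..n}"
    and nonneg: "\<And>k. 0 \<le> u k" "\<And>k. 0 \<le> q k" and le1: "\<And>K. (\<Sum>k\<le>K. u k) \<le> 1" "\<And>K. (\<Sum>k\<le>K. q k) \<le> 1"
    and s: "0 \<le> s" "s \<le> (\<Sum>k\<le>K0. \<bar>u k - q k\<bar>)" and t: "0 < t"
  shows "prob {w \<in> space M. t \<le> (\<Prod>i\<in>{1..n}. sqrt (u (Z i w) / q (Z i w)))} \<le> exp (- real n * s\<^sup>2 / 8) / t"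
proof (rule prob_ge_le)
  have [measurable]: "Z i \<in> measurable M (count_space UNIV)" if "i \<in> {1..n}" for i
    using distributed_measurable[OF Z[OF that]] .
  show "(\<lambda>w. \<Prod>i\<in>{1..n}. sqrt (u (Z i w) / q (Z i w))) \<in> borel_measurable M"
    by (intro borel_measurable_prod) measurable
  have "(\<integral>\<^sup>+w. ennreal (\<Prod>i\<in>{1..n}. sqrt (u (Z i w) / q (Z i w))) \<partial>M)
      = (\<integral>\<^sup>+w. (\<Prod>i\<in>{1..n}. ennreal (sqrt (u (Z i w) / q (Z i w)))) \<partial>M)"
    using nonneg by (simp add: prod_ennreal)
  also have "\<dots> = (\<Prod>i\<in>{1..n}. \<integral>\<^sup>+w. ennreal (sqrt (u (Z i w) / q (Z i w))) \<partial>M)"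
    by (rule indep_vars_nn_integral[OF _ indep_vars_compose2[OF indep]]) auto
  also have "\<dots> \<le> (\<Prod>i\<in>{1..n}. ennreal (exp (- s\<^sup>2 / 8)))"
    using nonneg le1 s by (intro prod_mono_ennreal nn_integral_sqrt_ratio_le[OF Z]) auto
  also have "\<dots> = ennreal (exp (- real n * s\<^sup>2 / 8))"
    by (simp add: ennreal_power exp_of_nat_mult[symmetric])
  finally show "(\<integral>\<^sup>+w. ennreal (\<Prod>i\<in>{1..n}. sqrt (u (Z i w) / q (Z i w))) \<partial>M) \<le> ennreal (exp (- real n * s\<^sup>2 / 8))" .
qed (use t in auto)

lemma (in prob_space) prob_sum_ge_le:
  fixes q :: "nat \<Rightarrow> real"
  assumes Z: "\<And>i. i \<in> {1..n} \<Longrightarrow> distributed M (count_space UNIV) (Z i) (\<lambda>k. ennreal (q k))"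
    and q: "\<And>k. 0 \<le> q k" "\<And>K. (\<Sum>k\<le>K. real k * q k) \<le> B" and S: "0 < S"
  shows "prob {w \<in> space M. S \<le> real (\<Sum>i\<in>{1..n}. Z i w)} \<le> real n * B / S"
proof (rule prob_ge_le)
  have [measurable]: "Z i \<in> measurable M (count_space UNIV)" if "i \<in> {1..n}" for i
    using distributed_measurable[OF Z[OF that]] .
  show "(\<lambda>w. real (\<Sum>i\<in>{1..n}. Z i w)) \<in> borel_measurable M"
    unfolding of_nat_sum by (intro borel_measurable_sum) measurable
  have B: "0 \<le> B" using q(2)[of 0] by simp
  have single: "(\<integral>\<^sup>+w. ennreal (real (Z i w)) \<partial>M) \<le> ennreal B" if "i \<in> {1..n}" for i
  proof -
    have "(\<integral>\<^sup>+w. ennreal (real (Z i w)) \<partial>M) = (\<integral>\<^sup>+k. ennreal (q k) * ennreal (real k) \<partial>count_space UNIV)"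
      by (rule distributed_nn_integral[OF Z[OF that], symmetric]) simp
    also have "\<dots> = (\<Sum>k. ennreal (real k * q k))"
      using q by (simp add: nn_integral_count_space_nat mult.commute flip: ennreal_mult)
    also have "\<dots> \<le> ennreal B"
    proof (rule suminf_le_const)
      fix K :: nat
      have "(\<Sum>k<K. real k * q k) \<le> (\<Sum>k\<le>K. real k * q k)" using q by (intro sum_mono2) auto
      then have "(\<Sum>k<K. real k * q k) \<le> B" using q(2)[of K] by linarith
      then show "(\<Sum>k<K. ennreal (real k * q k)) \<le> ennreal B" using q by (simp add: ennreal_leI)
    qed auto
    finally show ?thesis .
  qed
  have "(\<integral>\<^sup>+w. ennreal (real (\<Sum>i\<in>{1..n}. Z i w)) \<partial>M) = (\<integral>\<^sup>+w. (\<Sum>i\<in>{1..n}. ennreal (real (Z i w))) \<partial>M)"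
    by (intro nn_integral_cong) simp
  also have "\<dots> = (\<Sum>i\<in>{1..n}. \<integral>\<^sup>+w. ennreal (real (Z i w)) \<partial>M)"
    by (rule nn_integral_sum) measurable
  also have "\<dots> \<le> (\<Sum>i\<in>{1..n}. ennreal B)" using single by (intro sum_mono) auto
  also have "\<dots> = ennreal (real n * B)" using B by (simp add: ennreal_of_nat_eq_real_of_nat ennreal_mult)
  finally show "(\<integral>\<^sup>+w. ennreal (real (\<Sum>i\<in>{1..n}. Z i w)) \<partial>M) \<le> ennreal (real n * B)" .
  show "0 \<le> real n * B" using B by simp
qed fact

text \<open>At most \<open>Suc S\<close> values qualify, each with probability below \<delta>. This
  keeps the likelihood of the truth away from 0.\<close>

lemma (in prob_space) prob_small_mass_le:
  fixes q :: "nat \<Rightarrow> real"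
  assumes Z: "distributed M (count_space UNIV) X (\<lambda>k. ennreal (q k))" and \<delta>: "0 \<le> \<delta>"
  shows "prob {w \<in> space M. X w \<le> S \<and> q (X w) < \<delta>} \<le> real (Suc S) * \<delta>"
proof -
  let ?A = "{k. k \<le> S \<and> q k < \<delta>}"
  have "emeasure M {w \<in> space M. X w \<le> S \<and> q (X w) < \<delta>} = emeasure M (X -` ?A \<inter> space M)"
    by (rule arg_cong[where f="emeasure M"]) auto
  also have "\<dots> = (\<integral>\<^sup>+k. ennreal (q k) * indicator ?A k \<partial>count_space UNIV)"
    by (rule distributed_emeasure[OF Z]) simp
  also have "\<dots> \<le> (\<integral>\<^sup>+k. ennreal \<delta> * indicator {..S} k \<partial>count_space UNIV)"
    by (intro nn_integral_mono) (auto simp: indicator_def intro: ennreal_leI less_imp_le)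
  also have "\<dots> = ennreal (real (Suc S) * \<delta>)"
    using \<delta> by (simp add: nn_integral_cmult ennreal_mult ennreal_of_nat_eq_real_of_nat mult.commute)
  finally show ?thesis using \<delta> by (simp add: emeasure_eq_measure)
qed

subsection \<open>Posterior contraction\<close>

text \<open>Up to a constant, this bounds the total prior mass divided by the mass of the box near the truth.\<close>

definition volume_ratio :: "real \<Rightarrow> nat \<Rightarrow> nat \<Rightarrow> real" where
  "volume_ratio s n m = real n * real m ^ 2 * (1 / s) ^ m * (real n ^ 3 * real m) ^ m"

text \<open>The factor \<open>2 * exp 1\<close> is the loss of likelihood on the box near the truth,
  the bracket collects the mesh loss \<open>exp 1\<close> with the gamma total mass and the gamma
  tail, and the denominator is the gamma density at \<open>l0 + 1\<close> without its
  constant.\<close>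

definition contraction_const :: "real \<Rightarrow> real \<Rightarrow> real \<Rightarrow> real" where
  "contraction_const a b l0 = 2 * exp 1 * (exp 1 * (1 / a + 1 / b) + 1 / b)
    / ((l0 + 1) powr (a - 1) * exp (- b * (l0 + 1)))"

definition far_grid :: "real \<Rightarrow> real \<Rightarrow> nat \<Rightarrow> nat \<Rightarrow> (nat \<Rightarrow> real) \<Rightarrow> (nat \<Rightarrow> nat) set" where
  "far_grid e h G m v0 = {j \<in> PiE {1..m} (\<lambda>_. {..G}). e \<le> (\<Sum>k\<le>m. \<bar>grid_levy h m j k - v0 k\<bar>)}"

lemma volume_ratio_ge_1:
  assumes "1 \<le> n" "1 \<le> m" "0 < s" "s \<le> 1"
  shows "1 \<le> volume_ratio s n m"
proof -
  have "1 \<le> real n * real m ^ 2" "1 \<le> real n ^ 3 * real m"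
    using assms by (auto intro!: mult_ge1_I one_le_power)
  moreover have "1 \<le> (1 / s) ^ m" using assms by (intro one_le_power) auto
  ultimately show ?thesis
    unfolding volume_ratio_def by (intro mult_ge1_I[OF mult_ge1_I] one_le_power[of "_ * _"])
qed

lemma l1_dist_simplex:
  assumes "simplex_pmf m p" "simplex_pmf m p0"
  shows "l1_dist (levy l p) (levy l0 p0) = (\<Sum>k\<le>m. \<bar>levy l p k - levy l0 p0 k\<bar>)"
  unfolding l1_dist_def using assms
  by (intro suminf_finite) (auto simp: simplex_pmf_def levy_def)

text \<open>The deterministic half of the argument: randomness enters only through three conditions
  on \<open>z\<close>. With \<open>Q\<close> the likelihood of the truth, the numerator integrand is
  at most \<open>exp 1 * \<tau>^2 * Q\<close> over the grid range, the denominator integrand is at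
  least \<open>Q / (2 * exp 1)\<close> on the box, and \<open>Q\<close> cancels.\<close>

lemma posterior_le_of_typical:
  assumes l0: "0 < l0" and p0: "simplex_pmf m p0" "p0 m = 0"
    and ab: "0 < a" "a \<le> 1" "0 < b" and nm: "2 \<le> n" "1 \<le> m"
    and s: "0 < s" "s \<le> 1" and al: "\<And>i. i \<in> {1..m} \<Longrightarrow> s \<le> al i \<and> al i \<le> 1"
    and sum_z: "(\<Sum>i\<in>{1..n}. z i) \<le> n ^ 2"
    and q_z: "\<And>i. i \<in> {1..n} \<Longrightarrow> exp (- real n) \<le> compound_poisson l0 p0 (z i)"
    and grid: "\<And>j. j \<in> far_grid (\<epsilon> - 1 / n) (1 / (real n * real m)) (n ^ 4 * m) m (levy l0 p0) \<Longrightarrow>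
      (\<Prod>i\<in>{1..n}. sqrt (grid_fps (1 / (real n * real m)) m j $ z i / compound_poisson l0 p0 (z i))) \<le> \<tau>"
  shows "\<bar>posterior (prior a b m al) n z {(l, p). l1_dist (levy l p) (levy l0 p0) \<ge> \<epsilon>}\<bar>
    \<le> contraction_const a b l0 * (volume_ratio s n m * (\<tau>\<^sup>2 + exp (real n ^ 2 - b * real n ^ 3)))"
proof -
  define q where "q = compound_poisson l0 p0"
  define h where "h = 1 / (real n * real m)"
  define P where "P = prior a b m al"
  define A where "A = {(l, p). l1_dist (levy l p) (levy l0 p0) \<ge> \<epsilon>}"
  define Q where "Q = (\<Prod>i\<in>{1..n}. q (z i))"
  \<comment> \<open>Shrinking \<open>p0\<close> by \<open>1 - \<delta>\<close> frees the mass
    \<delta>, and \<open>d = \<delta> / m\<close> lets the \<open>m - 1\<close> sides of the box fit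
    into it. The size of \<delta> makes \<open>(1 - \<delta>) ^ (n ^ 2)\<close> at least
    1/2.\<close>
  define d where "d = 1 / (real n ^ 3 * real m)"
  define \<delta> where "\<delta> = 1 / real n ^ 3"
  \<comment> \<open>The intensities beyond the reach of the grid: \<open>n ^ 4 * m\<close> cells of
    mesh \<open>h\<close> end at \<open>n ^ 3\<close>.\<close>
  define T where "T = {real n ^ 3<..} \<times> (UNIV :: (nat \<Rightarrow> real) set)"
  define Bx where "Bx = {l0..l0 + 1 / real n} \<times> dirichlet_box m (\<lambda>k. (1 - \<delta>) * p0 k) d"
  define N where "N = exp 1 * \<tau>\<^sup>2 * Q"
  define D where "D = exp (- 1) * (1 / 2) * Q"
  define cD where "cD = dirichlet_const m al"
  define cG where "cG = gamma_const a b"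
  define E where "E = exp (real n ^ 2 - b * real n ^ 3)"
  define r where "r = (l0 + 1) powr (a - 1) * exp (- b * (l0 + 1))"
  have al': "\<And>i. i \<in> {1..m} \<Longrightarrow> 0 < al i \<and> al i \<le> 1" using al s by force
  have c: "0 < cG" "0 < cD" "0 < r" using nm al' ab l0
    by (auto simp: cG_def cD_def r_def intro!: dirichlet_const_pos gamma_const_pos)
  have h: "0 < h" "real n * (real m * h) = 1" "real m * h = 1 / real n" "real (n ^ 4 * m) * h = real n ^ 3"
    using nm by (auto simp: h_def field_simps power_numeral_reduce)
  have d: "0 < d" "d = \<delta> / real m" using nm by (auto simp: d_def \<delta>_def)
  have \<delta>: "0 < \<delta>" "\<delta> \<le> 1" using nm by (auto simp: \<delta>_def intro!: divide_le_eq_1_pos[THEN iffD2])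
  have p0': "0 \<le> p0 k" "p0 0 = 0" "m \<le> k \<Longrightarrow> p0 k = 0" "(\<Sum>k\<in>{1..m}. p0 k) = 1" for k
    using p0 by (auto simp: simplex_pmf_def le_less)
  have q0: "exp (- real n) \<le> q (z i)" if "i \<in> {1..n}" for i
    using q_z[OF that] by (simp add: q_def)
  have qpos: "0 < q (z i)" if "i \<in> {1..n}" for i using q0[OF that] by (rule less_le_trans[rotated]) simp
  have "exp (- (real n ^ 2)) = (\<Prod>i\<in>{1..n}. exp (- real n))"
    by (simp add: exp_of_nat_mult[symmetric] power2_eq_square)
  also have "\<dots> \<le> Q" unfolding Q_def using q0 by (intro prod_mono) auto
  finally have Q: "exp (- (real n ^ 2)) \<le> Q" .
  then have Qpos: "0 < Q" by (rule less_le_trans[rotated]) simp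
  note prior = finite_measure_prior[OF ab nm(2) s al] AE_prior[OF ab nm(2) s al]
  interpret finite_measure P unfolding P_def by (rule prior(1))
  have AEP: "AE t in P. 0 < fst t \<and> simplex_pmf m (snd t)" unfolding P_def by (rule prior(2))
  have space: "space P = UNIV" by (simp add: P_def prior_def space_pair_measure)
  have UNIV_sets: "UNIV \<in> sets (dirichlet m al)" using sets.top[of "dirichlet m al"] by simp
  have sets: "T \<in> sets P" "Bx \<in> sets P"
    unfolding T_def Bx_def P_def prior_def using UNIV_sets
    by (auto intro!: pair_measureI simp del: sets_dirichlet) (simp add: sets_dirichlet_box)
  have lik: "AE t in P. 0 \<le> likelihood n z t \<and> likelihood n z t \<le> 1"
    using AEP
  proof eventually_elim
    case (elim t)
    then show ?case
      using compound_poisson_bounds[of "fst t" m "snd t"]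
      by (cases t) (auto simp: likelihood_def intro!: prod_nonneg prod_le_1)
  qed
  have num: "AE t in P. t \<in> A \<longrightarrow> t \<notin> T \<longrightarrow> likelihood n z t \<le> N"
    using AEP
  proof (eventually_elim, intro impI)
    fix t assume t: "0 < fst t \<and> simplex_pmf m (snd t)" "t \<in> A" "t \<notin> T"
    obtain l p where lp: "t = (l, p)" by (cases t)
    have l: "0 < l" "l \<le> real (n ^ 4 * m) * h" and p: "simplex_pmf m p"
      using t h by (auto simp: lp T_def)
    obtain j where j: "j \<in> PiE {1..m} (\<lambda>_. {..n ^ 4 * m})"
      "\<And>k. \<bar>grid_levy h m j k - levy l p k\<bar> \<le> (if k \<in> {1..m} then h else 0)"
      "\<And>z. compound_poisson l p z \<le> exp (real m * h) * grid_fps h m j $ z"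
      using compound_poisson_le_grid[OF h(1) l p] by blast
    \<comment> \<open>Passing to the corner moves the Levy measure by at most
      \<open>m * h = 1 / n\<close>, which is why the grid condition uses the radius
      \<open>\<epsilon> - 1 / n\<close>.\<close>
    have "\<epsilon> \<le> (\<Sum>k\<le>m. \<bar>levy l p k - levy l0 p0 k\<bar>)"
      using t(2) by (simp add: A_def lp l1_dist_simplex[OF p p0(1)])
    also have "\<dots> \<le> (\<Sum>k\<le>m. \<bar>grid_levy h m j k - levy l0 p0 k\<bar> + (if k \<in> {1..m} then h else 0))"
    proof (rule sum_mono)
      fix k
      show "\<bar>levy l p k - levy l0 p0 k\<bar> \<le> \<bar>grid_levy h m j k - levy l0 p0 k\<bar> + (if k \<in> {1..m} then h else 0)"
        using j(2)[of k] by linarith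
    qed
    also have "\<dots> = (\<Sum>k\<le>m. \<bar>grid_levy h m j k - levy l0 p0 k\<bar>) + (\<Sum>k\<in>{..m} \<inter> {1..m}. h)"
      by (simp only: sum.distrib sum.inter_restrict[OF finite_atMost])
    also have "{..m} \<inter> {1..m} = {1..m}" by auto
    also have "(\<Sum>k\<in>{1..m}. h) = 1 / n" using h(3) by simp
    finally have "j \<in> far_grid (\<epsilon> - 1 / n) h (n ^ 4 * m) m (levy l0 p0)"
      using j(1) by (simp add: far_grid_def)
    then have \<tau>: "(\<Prod>i\<in>{1..n}. sqrt (grid_fps h m j $ z i / q (z i))) \<le> \<tau>"
      using grid unfolding h_def q_def by blast
    have "likelihood n z t \<le> (\<Prod>i\<in>{1..n}. exp (real m * h) * grid_fps h m j $ z i)"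
      unfolding lp likelihood_def prod.case
      using j(3) compound_poisson_bounds[OF less_imp_le[OF l(1)] p] by (intro prod_mono) auto
    also have "\<dots> = exp 1 * (\<Prod>i\<in>{1..n}. grid_fps h m j $ z i)"
      using h(2) by (simp add: prod.distrib exp_of_nat_mult[symmetric])
    \<comment> \<open>The grid condition controls square roots of ratios, as the affinity does,
      hence the square of \<tau>.\<close>
    also have "(\<Prod>i\<in>{1..n}. grid_fps h m j $ z i)
        = (\<Prod>i\<in>{1..n}. (sqrt (grid_fps h m j $ z i / q (z i)))\<^sup>2 * q (z i))"
    proof (rule prod.cong)
      fix i assume "i \<in> {1..n}"
      then have "0 \<le> grid_fps h m j $ z i / q (z i)" "q (z i) \<noteq> 0"
        using qpos[of i] grid_fps_nonneg[of h m j "z i"] h(1) by auto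
      then show "grid_fps h m j $ z i = (sqrt (grid_fps h m j $ z i / q (z i)))\<^sup>2 * q (z i)"
        by (simp only: real_sqrt_pow2) simp
    qed simp
    also have "\<dots> = (\<Prod>i\<in>{1..n}. sqrt (grid_fps h m j $ z i / q (z i)))\<^sup>2 * Q"
      by (simp add: prod.distrib prod_power_distrib Q_def)
    also have "exp 1 * \<dots> \<le> exp 1 * (\<tau>\<^sup>2 * Q)"
    proof (intro mult_left_mono mult_right_mono power_mono \<tau> prod_nonneg ballI)
      fix i assume "i \<in> {1..n}"
      then show "0 \<le> sqrt (grid_fps h m j $ z i / q (z i))"
        using qpos[of i] grid_fps_nonneg[of h m j "z i"] h(1) by simp
    qed (use Qpos in auto)
    finally show "likelihood n z t \<le> N" by (simp add: N_def mult.assoc)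
  qed
  have den: "AE t in P. t \<in> Bx \<longrightarrow> D \<le> likelihood n z t"
    using AEP
  proof (eventually_elim, intro impI)
    fix t assume t: "0 < fst t \<and> simplex_pmf m (snd t)" "t \<in> Bx"
    obtain l p where lp: "t = (l, p)" by (cases t)
    have "1 + real (n ^ 2) * (- \<delta>) \<le> (1 + (- \<delta>)) ^ (n ^ 2)"
      using \<delta> by (intro Bernoulli_inequality) auto
    moreover have "real (n ^ 2) * \<delta> = 1 / real n"
      using nm by (simp add: \<delta>_def power2_eq_square power3_eq_cube)
    moreover have "1 / real n \<le> 1 / 2" using nm by (simp add: divide_simps)
    ultimately have half: "1 / 2 \<le> (1 - \<delta>) ^ (n ^ 2)" by simp
    have "D \<le> exp (- real n * (1 / real n)) * (1 - \<delta>) ^ (n ^ 2) * Q"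
      unfolding D_def using half nm Qpos by (intro mult_right_mono mult_mono) auto
    also have "\<dots> \<le> likelihood n z t"
      unfolding Q_def q_def lp using t lp l0 \<delta> p0' sum_z
      by (intro likelihood_ge_box[where m = m and d = d]) (auto simp: Bx_def)
    finally show "D \<le> likelihood n z t" .
  qed
  have box_sum: "(\<Sum>k\<in>{1..<m}. (1 - \<delta>) * p0 k + d) < 1"
  proof -
    have "(\<Sum>k\<in>{1..<m}. p0 k) \<le> (\<Sum>k\<in>{1..m}. p0 k)" using p0' by (intro sum_mono2) auto
    then have "(1 - \<delta>) * (\<Sum>k\<in>{1..<m}. p0 k) \<le> (1 - \<delta>) * 1"
      using \<delta> p0'(4) by (intro mult_left_mono) auto
    moreover have "real (m - 1) * d < \<delta>"
    proof -
      have "real m * d = \<delta>" using nm d(2) by simp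
      then show ?thesis using nm d(1) by (simp only: of_nat_diff left_diff_distrib)
    qed
    ultimately show ?thesis
      by (simp add: sum.distrib sum_distrib_left[symmetric])
  qed
  have mB: "cG * r * (1 / real n) * (cD * d ^ (m - 1)) \<le> measure P Bx"
    unfolding P_def Bx_def cG_def cD_def r_def mult.assoc[symmetric]
    using measure_prior_box_ge[where a = a and b = b and m = m and s = s and al = al
        and l = l0 and h = "1 / real n" and d = d and \<beta> = "\<lambda>k. (1 - \<delta>) * p0 k"]
      ab nm s al l0 d \<delta> p0' box_sum by (simp add: mult.assoc)
  have mBpos: "0 < cG * r * (1 / real n) * (cD * d ^ (m - 1))" using c d nm by simp
  define W where "W = cD * (real m ^ 2 * (1 / s) ^ m)"
  have W: "0 < W" using c nm s by (simp add: W_def)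
  have mU: "measure P (space P) \<le> cG * (1 / a + 1 / b) * W"
    unfolding space unfolding P_def cG_def W_def cD_def by (rule measure_prior_UNIV_le[OF ab nm(2) s al])
  have mT: "measure P T \<le> cG / b * exp (- b * real n ^ 3) * W"
    unfolding T_def P_def cG_def W_def cD_def
    using nm by (intro measure_prior_tail_le[OF ab nm(2) s al]) auto
  \<comment> \<open>The tail mass carries no likelihood factor;
    \<open>exp (- (real n ^ 2)) \<le> Q\<close> supplies the \<open>Q\<close> needed for the
    cancellation.\<close>
  have "exp (- b * real n ^ 3) = E * exp (- (real n ^ 2))"
    by (simp add: E_def mult_exp_exp)
  also have "\<dots> \<le> E * Q" using Q by (intro mult_left_mono) (auto simp: E_def)
  finally have EQ: "exp (- b * real n ^ 3) \<le> E * Q" .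
  have E: "0 < E" by (simp add: E_def)
  have "\<bar>posterior P n z A\<bar> \<le> (N * measure P (space P) + measure P T) / (D * measure P Bx)"
  proof (rule posterior_bounds[OF _ lik num sets(1) _ den sets(2)])
    show "finite_measure P" by (rule finite_measure_axioms)
    show "0 \<le> N" "0 < D" using Qpos by (auto simp: N_def D_def)
    show "0 < measure P Bx" using mB mBpos by linarith
  qed
  also have "\<dots> \<le> (Q * cG * W * (exp 1 * (1 / a + 1 / b) + 1 / b) * (\<tau>\<^sup>2 + E))
      / (D * (cG * r * (1 / real n) * (cD * d ^ (m - 1))))"
  proof (rule frac_le)
    have "N * measure P (space P) \<le> N * (cG * (1 / a + 1 / b) * W)"
      using mU Qpos by (intro mult_left_mono) (auto simp: N_def)
    moreover have "measure P T \<le> cG / b * (E * Q) * W"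
      using mT EQ c ab W by (intro order_trans[OF mT] mult_right_mono mult_left_mono) auto
    moreover have "N * (cG * (1 / a + 1 / b) * W) + cG / b * (E * Q) * W
        = Q * cG * W * (exp 1 * (1 / a + 1 / b) * \<tau>\<^sup>2 + 1 / b * E)"
      by (simp add: N_def algebra_simps)
    moreover have "exp 1 * (1 / a + 1 / b) * \<tau>\<^sup>2 + 1 / b * E
        \<le> (exp 1 * (1 / a + 1 / b) + 1 / b) * (\<tau>\<^sup>2 + E)"
      unfolding distrib_left distrib_right using ab E by simp
    then have "Q * cG * W * (exp 1 * (1 / a + 1 / b) * \<tau>\<^sup>2 + 1 / b * E)
        \<le> Q * cG * W * ((exp 1 * (1 / a + 1 / b) + 1 / b) * (\<tau>\<^sup>2 + E))"
      using Qpos c W by (intro mult_left_mono) auto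
    ultimately show "N * measure P (space P) + measure P T
        \<le> Q * cG * W * (exp 1 * (1 / a + 1 / b) + 1 / b) * (\<tau>\<^sup>2 + E)"
      by (simp add: mult.assoc)
    show "0 < D * (cG * r * (1 / real n) * (cD * d ^ (m - 1)))"
      using Qpos by (intro mult_pos_pos[OF _ mBpos]) (simp add: D_def)
    show "D * (cG * r * (1 / real n) * (cD * d ^ (m - 1))) \<le> D * measure P Bx"
      using mB Qpos by (intro mult_left_mono) (auto simp: D_def)
    show "0 \<le> Q * cG * W * (exp 1 * (1 / a + 1 / b) + 1 / b) * (\<tau>\<^sup>2 + E)"
      using Qpos c W ab E by (intro mult_nonneg_nonneg add_nonneg_nonneg) auto
  qed
  also have "\<dots> = contraction_const a b l0 * (real n * real m ^ 2 * (1 / s) ^ m * (1 / d) ^ (m - 1)) * (\<tau>\<^sup>2 + E)"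
  proof -
    \<comment> \<open>The likelihood of the truth and both prior constants cancel here; for the
      Dirichlet constant, whose parameters vary with \<open>n\<close>, this is essential to the
      final rate.\<close>
    have key: "(Q * cG * (cD * U) * X * Y) / (1 / x * (1 / 2) * Q * (cG * r * (1 / k) * (cD * y)))
        = 2 * x * X / r * (k * U * (1 / y)) * Y" if "0 < x" "0 < k" "0 < y" for U X Y x k y :: real
      using that c Qpos by (simp add: field_simps)
    have "exp (- 1 :: real) = 1 / exp 1" by (simp add: exp_minus divide_inverse)
    moreover have "(1 / d) ^ (m - 1) = 1 / d ^ (m - 1)" by (simp add: power_divide)
    ultimately show ?thesis
      unfolding D_def W_def contraction_const_def r_def[symmetric]
      using key[of "exp 1" "real n" "d ^ (m - 1)" "real m ^ 2 * (1 / s) ^ m" _ "\<tau>\<^sup>2 + E"] d nm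
      by (simp only: mult.assoc) simp
  qed
  also have "\<dots> \<le> contraction_const a b l0 * volume_ratio s n m * (\<tau>\<^sup>2 + E)"
  proof (intro mult_right_mono mult_left_mono)
    have "1 / d = real n ^ 3 * real m" by (simp add: d_def)
    moreover have "1 \<le> real n ^ 3 * real m" using nm by (intro mult_ge1_I one_le_power) auto
    ultimately have "(1 / d) ^ (m - 1) \<le> (real n ^ 3 * real m) ^ m"
      by (simp only:) (intro power_increasing, auto)
    then show "real n * real m ^ 2 * (1 / s) ^ m * (1 / d) ^ (m - 1) \<le> volume_ratio s n m"
      unfolding volume_ratio_def using s by (intro mult_left_mono) auto
    show "0 \<le> contraction_const a b l0"
      using ab l0 by (auto simp: contraction_const_def intro!: divide_nonneg_pos mult_nonneg_nonneg add_nonneg_nonneg)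
  qed (use E in simp)
  finally show ?thesis by (simp add: P_def A_def E_def mult.assoc)
qed

text \<open>The contrapositive of the stability of the Levy measure: laws closer than claimed would
  put the corner at distance less than \<open>e\<close> from the truth.\<close>

lemma far_grid_l1:
  assumes l0: "0 < l0" and p0: "simplex_pmf m p0" and h: "0 \<le> h" and e: "0 \<le> e" "e \<le> 1"
    and j: "j \<in> far_grid e h G m (levy l0 p0)"
  shows "e / (2 * (1 + l0) * exp (2 * l0)) \<le> (\<Sum>k\<le>m. \<bar>grid_fps h m j $ k - compound_poisson l0 p0 k\<bar>)"
proof (rule ccontr)
  define C where "C = 2 * (1 + l0) * exp (2 * l0)"
  define x where "x = fps_l1 m (grid_fps h m j - cp_fps l0 (levy l0 p0))"
  have p0': "0 \<le> p0 k" "k \<notin> {1..m} \<Longrightarrow> p0 k = 0" "(\<Sum>k\<in>{1..m}. p0 k) = 1" for k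
    using p0 by (auto simp: simplex_pmf_def)
  have C: "0 < C" using l0 by (simp add: C_def)
  have "(\<Sum>k\<le>m. \<bar>grid_fps h m j $ k - compound_poisson l0 p0 k\<bar>) = x"
    using p0'(2)[of 0] by (simp add: x_def fps_l1_def compound_poisson_eq_cp_fps)
  moreover assume "\<not> e / (2 * (1 + l0) * exp (2 * l0)) \<le> (\<Sum>k\<le>m. \<bar>grid_fps h m j $ k - compound_poisson l0 p0 k\<bar>)"
  ultimately have x: "x < e / C" by (simp add: C_def)
  \<comment> \<open>The bound \<open>e \<le> 1\<close> brings the distance below the threshold of
    \<open>levy_l1_stability\<close>.\<close>
  have "e / C \<le> 1 / (2 * exp (2 * l0))"
    using e l0 by (intro frac_le) (auto simp: C_def)
  moreover have "exp (- 2 * l0) = 1 / exp (2 * l0)" by (simp add: exp_minus divide_inverse)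
  ultimately have small: "x \<le> exp (- 2 * l0) / 2" using x by simp
  have "(\<Sum>k\<le>m. \<bar>grid_levy h m j k - levy l0 p0 k\<bar>) \<le> C * x"
    unfolding C_def x_def grid_fps_def
  proof (rule levy_l1_stability)
    show "fps_l1 m (Abs_fps (levy l0 p0)) \<le> l0"
    proof -
      have "fps_l1 m (Abs_fps (levy l0 p0)) \<le> (\<Sum>k\<in>{1..m}. levy l0 p0 k)"
        using p0' l0 by (intro fps_l1_Abs_fps_le) (auto simp: levy_def)
      also have "\<dots> = l0" using p0'(3) by (simp add: levy_def flip: sum_distrib_left)
      finally show ?thesis .
    qed
    show "fps_l1 m (cp_fps (\<Sum>k\<in>{1..m}. grid_levy h m j k) (grid_levy h m j) - cp_fps l0 (levy l0 p0))
        \<le> exp (- 2 * l0) / 2"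
      using small by (simp add: x_def grid_fps_def)
  qed (use p0'(2)[of 0] in \<open>auto simp: grid_levy_def levy_def\<close>)
  moreover have "C * x < e" using x C by (simp add: pos_less_divide_eq mult.commute)
  moreover have "e \<le> (\<Sum>k\<le>m. \<bar>grid_levy h m j k - levy l0 p0 k\<bar>)" using j by (simp add: far_grid_def)
  ultimately show False by linarith
qed

text \<open>The three terms bound the ways a sample can be atypical: a sum of at least
  \<open>n ^ 2\<close>, an observation of very small probability under the truth, and a far grid
  corner with too large a likelihood ratio.\<close>

lemma (in prob_space) prob_posterior_gt_le:
  assumes l0: "0 < l0" and p0: "simplex_pmf m p0" "p0 m = 0"
    and B: "\<And>K. (\<Sum>k\<le>K. real k * levy l0 p0 k) \<le> B"
    and Z: "\<And>i. i \<in> {1..n} \<Longrightarrow> distributed M (count_space UNIV) (Z i) (\<lambda>k. ennreal (compound_poisson l0 p0 k))"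
    and indep: "indep_vars (\<lambda>_. count_space UNIV) Z {1..n}"
    and ab: "0 < a" "a \<le> 1" "0 < b" and nm: "2 \<le> n" "1 \<le> m"
    and s: "0 < s" "s \<le> 1" and al: "\<And>i. i \<in> {1..m} \<Longrightarrow> s \<le> al i \<and> al i \<le> 1"
    and \<epsilon>: "1 / n \<le> \<epsilon>" "\<epsilon> - 1 / n \<le> 1" and \<tau>: "0 < \<tau>"
    and \<eta>: "contraction_const a b l0 * (volume_ratio s n m * (\<tau>\<^sup>2 + exp (real n ^ 2 - b * real n ^ 3))) \<le> \<eta>"
  shows "prob {w \<in> space M. \<eta> < \<bar>posterior (prior a b m al) n (\<lambda>i. Z i w) {(l, p). l1_dist (levy l p) (levy l0 p0) \<ge> \<epsilon>}\<bar>}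
    \<le> B / n + n * real (Suc (n ^ 2)) * exp (- real n)
      + real (Suc (n ^ 4 * m)) ^ m * (exp (- real n * ((\<epsilon> - 1 / n) / (2 * (1 + l0) * exp (2 * l0)))\<^sup>2 / 8) / \<tau>)"
    (is "prob ?bad \<le> ?b1 + ?b2 + _ * ?b3")
proof -
  define q where "q = compound_poisson l0 p0"
  define h where "h = 1 / (real n * real m)"
  define e where "e = \<epsilon> - 1 / n"
  define J where "J = far_grid e h (n ^ 4 * m) m (levy l0 p0)"
  define E1 where "E1 = {w \<in> space M. real (n ^ 2) \<le> real (\<Sum>i\<in>{1..n}. Z i w)}"
  \<comment> \<open>The cut at \<open>n ^ 2\<close>, automatic off \<open>E1\<close>, leaves
    finitely many values to sum over.\<close>
  define E2 where "E2 i = {w \<in> space M. Z i w \<le> n ^ 2 \<and> q (Z i w) < exp (- real n)}" for i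
  define E3 where "E3 j = {w \<in> space M. \<tau> \<le> (\<Prod>i\<in>{1..n}. sqrt (grid_fps h m j $ Z i w / q (Z i w)))}" for j
  have p0': "0 \<le> p0 k" "k \<notin> {1..m} \<Longrightarrow> p0 k = 0" "(\<Sum>k\<in>{1..m}. p0 k) = 1" for k
    using p0 by (auto simp: simplex_pmf_def)
  have q: "q k = cp_fps l0 (levy l0 p0) $ k" for k
    unfolding q_def using p0'(2)[of 0] by (intro compound_poisson_eq_cp_fps) auto
  have q_nonneg: "0 \<le> q k" for k
    using compound_poisson_bounds[OF less_imp_le[OF l0] p0(1)] by (simp add: q_def)
  have levy_l1: "fps_l1 K (Abs_fps (levy l0 p0)) \<le> l0" for K
  proof -
    have "fps_l1 K (Abs_fps (levy l0 p0)) \<le> (\<Sum>k\<in>{1..m}. levy l0 p0 k)"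
      using p0' l0 by (intro fps_l1_Abs_fps_le) (auto simp: levy_def)
    also have "\<dots> = l0" using p0'(3) by (simp add: levy_def flip: sum_distrib_left)
    finally show ?thesis .
  qed
  have q_le1: "(\<Sum>k\<le>K. q k) \<le> 1" for K
    using fps_l1_cp_fps[OF levy_l1[of K]] q_nonneg by (simp add: fps_l1_def flip: q)
  have q_moment: "(\<Sum>k\<le>K. real k * q k) \<le> B" for K
    unfolding q using p0' l0 levy_l1 B by (intro cp_fps_first_moment) (auto simp: levy_def)
  have h: "0 < h" using nm by (simp add: h_def)
  have grid: "0 \<le> grid_fps h m j $ k" "(\<Sum>k\<le>K. grid_fps h m j $ k) \<le> 1" for j k K
    using fps_l1_grid_fps[of h K m j] grid_fps_nonneg[of h m j] h by (auto simp: fps_l1_def)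
  have [measurable]: "Z i \<in> measurable M (count_space UNIV)" if "i \<in> {1..n}" for i
    using distributed_measurable[OF Z[OF that]] .
  have J: "finite J" "card J \<le> Suc (n ^ 4 * m) ^ m"
  proof -
    have sub: "J \<subseteq> PiE {1..m} (\<lambda>_. {..n ^ 4 * m})" by (auto simp: J_def far_grid_def)
    have fin: "finite (PiE {1..m} (\<lambda>_. {..n ^ 4 * m}))" by (intro finite_PiE) auto
    show "finite J" using finite_subset[OF sub fin] .
    have "card J \<le> card (PiE {1..m} (\<lambda>_. {..n ^ 4 * m}))" using card_mono[OF fin sub] .
    also have "\<dots> = Suc (n ^ 4 * m) ^ m" by (simp add: card_PiE)
    finally show "card J \<le> Suc (n ^ 4 * m) ^ m" .
  qed
  have meas: "E1 \<in> events" "i \<in> {1..n} \<Longrightarrow> E2 i \<in> events" "E3 j \<in> events" for i j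
  proof -
    have "(\<lambda>w. \<Sum>i\<in>{1..n}. real (Z i w)) \<in> borel_measurable M"
      by (intro borel_measurable_sum) measurable
    then show "E1 \<in> events" unfolding E1_def of_nat_sum by measurable
    show "E2 i \<in> events" if "i \<in> {1..n}" unfolding E2_def using that by measurable
    have "(\<lambda>w. \<Prod>i\<in>{1..n}. sqrt (grid_fps h m j $ Z i w / q (Z i w))) \<in> borel_measurable M"
      by (intro borel_measurable_prod) measurable
    then show "E3 j \<in> events" unfolding E3_def by measurable
  qed
  have "?bad \<subseteq> E1 \<union> (\<Union>i\<in>{1..n}. E2 i) \<union> (\<Union>j\<in>J. E3 j)"
  proof
    fix w assume w: "w \<in> ?bad"
    show "w \<in> E1 \<union> (\<Union>i\<in>{1..n}. E2 i) \<union> (\<Union>j\<in>J. E3 j)"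
    proof (rule ccontr)
      assume not: "w \<notin> E1 \<union> (\<Union>i\<in>{1..n}. E2 i) \<union> (\<Union>j\<in>J. E3 j)"
      have sw: "w \<in> space M" using w by simp
      have sum: "(\<Sum>i\<in>{1..n}. Z i w) \<le> n ^ 2"
        using not sw unfolding E1_def by (simp only: of_nat_le_iff) auto
      have "exp (- real n) \<le> compound_poisson l0 p0 (Z i w)" if i: "i \<in> {1..n}" for i
      proof -
        have "Z i w \<le> (\<Sum>i\<in>{1..n}. Z i w)" using i by (intro member_le_sum) auto
        then have "Z i w \<le> n ^ 2" using sum by linarith
        moreover have "w \<notin> E2 i" using not i by blast
        ultimately show ?thesis using sw by (simp add: E2_def q_def)
      qed
      moreover have "(\<Prod>i\<in>{1..n}. sqrt (grid_fps h m j $ Z i w / q (Z i w))) \<le> \<tau>" if "j \<in> J" for j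
        using not that sw by (auto simp: E3_def)
      ultimately have "\<bar>posterior (prior a b m al) n (\<lambda>i. Z i w) {(l, p). l1_dist (levy l p) (levy l0 p0) \<ge> \<epsilon>}\<bar>
          \<le> contraction_const a b l0 * (volume_ratio s n m * (\<tau>\<^sup>2 + exp (real n ^ 2 - b * real n ^ 3)))"
        using sum unfolding J_def e_def h_def q_def
        by (intro posterior_le_of_typical[OF l0 p0 ab nm s al]) auto
      then show False using w \<eta> by simp
    qed
  qed
  moreover have unions: "(\<Union>i\<in>{1..n}. E2 i) \<in> events" "(\<Union>j\<in>J. E3 j) \<in> events"
    using meas J by (auto intro!: sets.finite_UN)
  \<comment> \<open>Measurability of the covering event suffices: a set outside
    \<open>events\<close> has measure 0 by convention.\<close>
  ultimately have "prob ?bad \<le> prob (E1 \<union> (\<Union>i\<in>{1..n}. E2 i) \<union> (\<Union>j\<in>J. E3 j))"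
    using meas(1) by (intro finite_measure_mono) auto
  also have "\<dots> \<le> prob (E1 \<union> (\<Union>i\<in>{1..n}. E2 i)) + prob (\<Union>j\<in>J. E3 j)"
    using meas(1) unions by (intro measure_Un_le) auto
  also have "\<dots> \<le> prob E1 + prob (\<Union>i\<in>{1..n}. E2 i) + prob (\<Union>j\<in>J. E3 j)"
    using meas(1) unions by (intro add_right_mono measure_Un_le) auto
  also have "\<dots> \<le> ?b1 + ?b2 + real (Suc (n ^ 4 * m)) ^ m * ?b3"
  proof (intro add_mono)
    have "prob E1 \<le> real n * B / real (n ^ 2)"
      unfolding E1_def using Z q_nonneg q_moment nm
      by (intro prob_sum_ge_le[where q = q]) (auto simp: q_def)
    then show "prob E1 \<le> ?b1" using nm by (simp add: power2_eq_square)
    have "prob (\<Union>i\<in>{1..n}. E2 i) \<le> (\<Sum>i\<in>{1..n}. prob (E2 i))"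
      using meas by (intro measure_UNION_le) auto
    also have "\<dots> \<le> (\<Sum>i\<in>{1..n}. real (Suc (n ^ 2)) * exp (- real n))"
      unfolding E2_def using Z by (intro sum_mono prob_small_mass_le) (auto simp: q_def)
    finally show "prob (\<Union>i\<in>{1..n}. E2 i) \<le> ?b2" by (simp add: mult.assoc)
    have "prob (\<Union>j\<in>J. E3 j) \<le> (\<Sum>j\<in>J. prob (E3 j))"
      using meas J by (intro measure_UNION_le) auto
    also have "\<dots> \<le> (\<Sum>j\<in>J. ?b3)"
    proof (rule sum_mono)
      fix j assume j: "j \<in> J"
      have e: "0 \<le> e" "e \<le> 1" using \<epsilon> by (auto simp: e_def)
      show "prob (E3 j) \<le> ?b3"
        unfolding E3_def e_def[symmetric]
      proof (rule prob_prod_sqrt_ratio_ge[where q = q])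
        show "e / (2 * (1 + l0) * exp (2 * l0)) \<le> (\<Sum>k\<le>m. \<bar>grid_fps h m j $ k - q k\<bar>)"
          unfolding q_def using j h e by (intro far_grid_l1[OF l0 p0(1)]) (auto simp: J_def)
        show "0 \<le> e / (2 * (1 + l0) * exp (2 * l0))" using e l0 by simp
      qed (use Z indep grid q_nonneg q_le1 \<tau> in \<open>auto simp: q_def\<close>)
    qed
    also have "\<dots> = real (card J) * ?b3" by simp
    also have "\<dots> \<le> real (Suc (n ^ 4 * m) ^ m) * ?b3"
      using J(2) \<tau> by (intro mult_right_mono of_nat_mono) auto
    finally show "prob (\<Union>j\<in>J. E3 j) \<le> real (Suc (n ^ 4 * m)) ^ m * ?b3" by simp
  qed
  finally show ?thesis .
qed

section \<open>Asymptotics in \<open>n\<close> and conclusion\<close>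

lemma finite_of_compact_nat: "compact (S :: nat set) \<Longrightarrow> finite S"
  by (metis compact_attains_sup emptyE finite_nat_set_iff_bounded_le)

text \<open>Powers with exponent \<open>m = O (log n)\<close> of quantities polynomial in
  \<open>n\<close> give \<open>exp (O (log^2 n))\<close>; single logarithms are absorbed by
  \<open>1 \<le> ln (real n)\<close>.\<close>

lemma volume_ratio_le:
  assumes n: "1 \<le> n" "1 \<le> ln (real n)" and m: "1 \<le> m" "m \<le> n" "real m \<le> C * ln (real n)"
    and s: "0 < s" "s \<le> 1"
  shows "volume_ratio s n m \<le> exp ((3 + C * ln (1 / s) + 4 * C) * ln (real n) ^ 2)"
proof -
  define L where "L = ln (real n)"
  have L: "1 \<le> L" "exp L = real n" "real m \<le> C * L" using n m by (auto simp: L_def)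
  have ls: "0 \<le> ln (1 / s)" using s by simp
  have C: "0 \<le> C" using L m by (metis le_less_trans less_eq_real_def mult_neg_pos not_le of_nat_0_le_iff zero_less_one less_le_trans)
  have LL: "L \<le> L\<^sup>2" using L by (simp add: power2_eq_square)
  have 1: "real n * real m ^ 2 \<le> exp (3 * L\<^sup>2)"
  proof -
    have "real n * real m ^ 2 \<le> real n * real n ^ 2"
      using m by (intro mult_left_mono power_mono) auto
    also have "\<dots> = exp (3 * L)"
      unfolding L(2)[symmetric] exp_of_nat_mult[symmetric] by (simp add: mult_exp_exp)
    finally show ?thesis using LL by (auto elim: order_trans)
  qed
  have 2: "(1 / s) ^ m \<le> exp (C * ln (1 / s) * L\<^sup>2)"
  proof -
    have "(1 / s) ^ m = exp (real m * ln (1 / s))"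
      using s by (simp add: exp_of_nat_mult)
    also have "real m * ln (1 / s) \<le> C * L\<^sup>2 * ln (1 / s)"
      using L(3) LL C ls by (intro mult_right_mono order_trans[OF L(3)] mult_left_mono) auto
    finally show ?thesis by (simp add: mult_ac)
  qed
  have 3: "(real n ^ 3 * real m) ^ m \<le> exp (4 * C * L\<^sup>2)"
  proof -
    have "real n ^ 3 * real m \<le> real n ^ 3 * real n" using m by (intro mult_left_mono) auto
    also have "\<dots> = exp (4 * L)"
      unfolding L(2)[symmetric] exp_of_nat_mult[symmetric] by (simp add: mult_exp_exp)
    finally have "(real n ^ 3 * real m) ^ m \<le> exp (4 * L) ^ m" by (intro power_mono) auto
    also have "\<dots> = exp (real m * (4 * L))" by (simp add: exp_of_nat_mult)
    also have "real m * (4 * L) \<le> C * L * (4 * L)" using L by (intro mult_right_mono) auto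
    finally show ?thesis by (simp add: power2_eq_square mult_ac)
  qed
  have "volume_ratio s n m \<le> exp (3 * L\<^sup>2) * exp (C * ln (1 / s) * L\<^sup>2) * exp (4 * C * L\<^sup>2)"
    unfolding volume_ratio_def using 1 2 3 s by (intro mult_mono) auto
  also have "\<dots> = exp ((3 + C * ln (1 / s) + 4 * C) * L\<^sup>2)"
    by (simp add: mult_exp_exp algebra_simps)
  finally show ?thesis by (simp add: L_def)
qed

text \<open>Since \<open>m \<le> n\<close> and \<open>n \<ge> 2\<close>, a coordinate takes at most
  \<open>n ^ 6\<close> values.\<close>

lemma card_grid_le:
  assumes n: "2 \<le> n" "1 \<le> ln (real n)" and m: "m \<le> n" "real m \<le> C * ln (real n)"
  shows "real (Suc (n ^ 4 * m)) ^ m \<le> exp (6 * C * ln (real n) ^ 2)"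
proof -
  have "Suc (n ^ 4 * m) \<le> Suc (n ^ 4 * n)" using m by simp
  also have "\<dots> \<le> n ^ 5 + n ^ 5"
    using n by (simp add: power_numeral_reduce mult_ac Suc_le_eq)
  also have "\<dots> \<le> n ^ 5 * n" using n by (simp add: mult_2_right[symmetric])
  finally have "real (Suc (n ^ 4 * m)) \<le> real (n ^ 6)"
    by (simp add: power_numeral_reduce mult_ac del: of_nat_Suc of_nat_power of_nat_mult)
  then have "real (Suc (n ^ 4 * m)) ^ m \<le> (real n ^ 6) ^ m" by (intro power_mono) auto
  also have "\<dots> = exp (real m * (6 * ln (real n)))"
  proof -
    have "real n ^ 6 = exp (6 * ln (real n))" using n exp_of_nat_mult[of 6 "ln (real n)"] by simp
    then show ?thesis by (simp add: exp_of_nat_mult)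
  qed
  also have "\<dots> \<le> exp (C * ln (real n) * (6 * ln (real n)))"
    using m n by (intro exp_mono mult_right_mono) auto
  finally show ?thesis by (simp add: power2_eq_square mult_ac)
qed

theorem theorem1:
  fixes M :: "'w measure" and Z :: "nat \<Rightarrow> 'w \<Rightarrow> nat"
    and l0 a b :: real and p0 :: "nat \<Rightarrow> real"
    and m :: "nat \<Rightarrow> nat" and al :: "nat \<Rightarrow> nat \<Rightarrow> real" and \<gamma> :: real
  assumes "0 < l0" and "is_pmf_pos p0"
    and "compact {k. levy l0 p0 k \<noteq> 0}"
    and "prob_space M"
    and "prob_space.indep_vars M (\<lambda>_. count_space UNIV) Z {1..}"
    and "\<And>i. 1 \<le> i \<Longrightarrow>
           distributed M (count_space UNIV) (Z i) (\<lambda>k. ennreal (compound_poisson l0 p0 k))"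
    and "\<And>n. 1 \<le> n \<Longrightarrow> 1 \<le> m n"
    and "(\<lambda>n. real (m n)) \<in> \<Theta>(\<lambda>n. ln (real n))"
    and "\<exists>al_low>0. \<forall>n\<ge>1. \<forall>i\<in>{1..m n}. al_low \<le> al n i \<and> al n i \<le> 1"
    and "0 < a" and "a \<le> 1" and "0 < b"
    and "1 < \<gamma>"
  shows "converges_in_prob M
           (\<lambda>n w. posterior (prior a b (m n) (al n)) n (\<lambda>i. Z i w)
              {(l, p). l1_dist (levy l p) (levy l0 p0) \<ge> ln (real n) powr \<gamma> / sqrt (real n)})
           0"
proof -
  interpret prob_space M by fact
  have p0: "p0 0 = 0" "\<And>k. 0 \<le> p0 k" "p0 sums 1"
    using \<open>is_pmf_pos p0\<close> by (auto simp: is_pmf_pos_def)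
  have "finite {k. levy l0 p0 k \<noteq> 0}" using assms(3) by (rule finite_of_compact_nat)
  then obtain K where K: "\<And>k. levy l0 p0 k \<noteq> 0 \<Longrightarrow> k < K"
    unfolding finite_nat_set_iff_bounded by auto
  have p0_K: "p0 k = 0" if "K \<le> k" for k
    using K[of k] that \<open>0 < l0\<close> by (auto simp: levy_def)
  have simplex: "simplex_pmf k p0" if "K \<le> k" for k
  proof -
    have zero: "p0 i = 0" if "i \<notin> {1..k}" for i
      using that \<open>K \<le> k\<close> p0(1) p0_K[of i] by (cases "i = 0") auto
    then have "p0 sums (\<Sum>i\<in>{1..k}. p0 i)" by (intro sums_finite) auto
    then show ?thesis using p0 zero sums_unique2[OF p0(3)] by (auto simp: simplex_pmf_def)
  qed
  define B where "B = (\<Sum>k\<le>K. real k * levy l0 p0 k)"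
  have B: "(\<Sum>k\<le>J. real k * levy l0 p0 k) \<le> B" for J
  proof -
    have "(\<Sum>k\<le>J. real k * levy l0 p0 k) = (\<Sum>k\<in>{..J} \<inter> {..K}. real k * levy l0 p0 k)"
      using p0_K by (intro sum.mono_neutral_right) (auto simp: levy_def)
    also have "\<dots> \<le> B"
      unfolding B_def using p0 \<open>0 < l0\<close> by (intro sum_mono2) (auto simp: levy_def)
    finally show ?thesis .
  qed
  obtain s0 where s0: "0 < s0" "\<And>n i. 1 \<le> n \<Longrightarrow> i \<in> {1..m n} \<Longrightarrow> s0 \<le> al n i \<and> al n i \<le> 1"
    using assms(9) by blast
  define s where "s = min s0 1"
  have s: "0 < s" "s \<le> 1" and al: "\<And>n i. 1 \<le> n \<Longrightarrow> i \<in> {1..m n} \<Longrightarrow> s \<le> al n i \<and> al n i \<le> 1"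
    using s0 unfolding s_def by force+
  obtain C where C: "0 < C" and m_le': "\<forall>\<^sub>F n in sequentially. norm (real (m n)) \<le> C * norm (ln (real n))"
    using landau_o.bigE[OF bigthetaD1[OF assms(8)]] by blast
  obtain c where c: "0 < c" and m_ge': "\<forall>\<^sub>F n in sequentially. norm (real (m n)) \<ge> c * norm (ln (real n))"
    using landau_omega.bigE[OF bigthetaD2[OF assms(8)]] by blast
  have ln_ge: "\<forall>\<^sub>F n in sequentially. 1 \<le> ln (real n)" by real_asymp
  have m_le: "\<forall>\<^sub>F n in sequentially. real (m n) \<le> C * ln (real n)"
    using m_le' ln_ge by eventually_elim simp
  \<comment> \<open>Beyond this point the prior reaches past the support of the truth and
    \<open>p0 (m n) = 0\<close>.\<close>
  have m_large: "\<forall>\<^sub>F n in sequentially. K \<le> m n"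
  proof -
    have "\<forall>\<^sub>F n in sequentially. real K / c \<le> ln (real n)" by real_asymp
    with m_ge' ln_ge show ?thesis
    proof eventually_elim
      case (elim n)
      then have "real K \<le> c * ln (real n)" using c by (simp add: pos_divide_le_eq mult.commute)
      then have "real K \<le> real (m n)" using elim by simp
      then show ?case by simp
    qed
  qed
  have m_small: "\<forall>\<^sub>F n in sequentially. m n \<le> n"
  proof -
    have "\<forall>\<^sub>F n in sequentially. C * ln (real n) \<le> real n" using C by real_asymp
    with m_le show ?thesis
    proof eventually_elim
      case (elim n)
      then have "real (m n) \<le> real n" by linarith
      then show ?case by simp
    qed
  qed
  define \<epsilon> where "\<epsilon> n = ln (real n) powr \<gamma> / sqrt (real n)" for n :: nat
  define A where "A = 3 + C * ln (1 / s) + 4 * C"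
  define V where "V n = volume_ratio s n (m n)" for n
  \<comment> \<open>Small enough that \<open>V n * (\<tau> n)^2 \<le> 1 / n\<close> tends to 0, yet
    \<open>1 / \<tau> n\<close> is still only \<open>exp (O (log^2 n))\<close> in the probability
    bound.\<close>
  define \<tau> where "\<tau> n = 1 / (real n * V n)" for n
  define R where "R = 2 * (1 + l0) * exp (2 * l0)"
  \<comment> \<open>The affinity exponent at half the radius: 8 from the Hellinger bound, 4 from the
    squared half, and the stability constant \<open>R\<close> squared.\<close>
  define k where "k = 1 / (32 * R\<^sup>2)"
  have R: "0 < R" using \<open>0 < l0\<close> by (simp add: R_def)
  have k: "0 < k" using R by (simp add: k_def)
  have A: "0 < A" using C s unfolding A_def by (intro add_pos_nonneg add_nonneg_pos mult_nonneg_nonneg) auto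
  define \<beta> where "\<beta> n = B / n + n * real (Suc (n ^ 2)) * exp (- real n)
    + exp ((6 * C + A + 1) * ln (real n) ^ 2 - k * (ln (real n) powr \<gamma>)\<^sup>2)" for n :: nat
  have "(\<lambda>n. B / n + n * real (Suc (n ^ 2)) * exp (- real n)
      + exp ((6 * C + A + 1) * ln (real n) ^ 2 - k * (ln (real n) powr \<gamma>)\<^sup>2)) \<longlonglongrightarrow> 0 + 0"
  proof (rule tendsto_add)
    show "(\<lambda>n. B / n + n * real (Suc (n ^ 2)) * exp (- real n)) \<longlonglongrightarrow> 0" by real_asymp
    \<comment> \<open>This is where \<gamma> > 1 decides: the subtracted term is of order
      \<open>log^(2 \<gamma>) n\<close>.\<close>
    show "(\<lambda>n. exp ((6 * C + A + 1) * ln (real n) ^ 2 - k * (ln (real n) powr \<gamma>)\<^sup>2)) \<longlonglongrightarrow> 0"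
      using k \<open>1 < \<gamma>\<close> C A by real_asymp
  qed
  then have \<beta>: "\<beta> \<longlonglongrightarrow> 0" unfolding \<beta>_def by simp
  have n_ge: "\<forall>\<^sub>F n :: nat in sequentially. 4 \<le> n" by (rule eventually_ge_at_top)
  have \<epsilon>_small: "\<forall>\<^sub>F n in sequentially. \<epsilon> n \<le> 1"
    unfolding \<epsilon>_def using \<open>1 < \<gamma>\<close> by real_asymp
  have main: "(\<lambda>n. prob {w \<in> space M. \<eta> < \<bar>posterior (prior a b (m n) (al n)) n (\<lambda>i. Z i w)
      {(l, p). l1_dist (levy l p) (levy l0 p0) \<ge> \<epsilon> n} - 0\<bar>}) \<longlonglongrightarrow> 0" if \<eta>: "0 < \<eta>" for \<eta>
  proof -
    have "(\<lambda>n::nat. contraction_const a b l0 * (1 / real n + exp (A * ln (real n) ^ 2)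
        * exp (real n ^ 2 - b * real n ^ 3))) \<longlonglongrightarrow> contraction_const a b l0 * (0 + 0)"
    proof (intro tendsto_mult tendsto_const tendsto_add)
      show "(\<lambda>n::nat. 1 / real n) \<longlonglongrightarrow> 0" by real_asymp
      show "(\<lambda>n::nat. exp (A * ln (real n) ^ 2) * exp (real n ^ 2 - b * real n ^ 3)) \<longlonglongrightarrow> 0"
        using A \<open>0 < b\<close> by real_asymp
    qed
    then have "\<forall>\<^sub>F n in sequentially. contraction_const a b l0 * (1 / real n + exp (A * ln (real n) ^ 2)
        * exp (real n ^ 2 - b * real n ^ 3)) < \<eta>"
      using \<eta> by (intro order_tendstoD(2)) auto
    then have "\<forall>\<^sub>F n in sequentially. prob {w \<in> space M. \<eta> < \<bar>posterior (prior a b (m n) (al n)) n (\<lambda>i. Z i w)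
      {(l, p). l1_dist (levy l p) (levy l0 p0) \<ge> \<epsilon> n}\<bar>} \<le> \<beta> n"
      using ln_ge m_le m_large m_small n_ge \<epsilon>_small
    proof eventually_elim
      case (elim n)
      have n: "1 \<le> n" "2 \<le> n" and m: "1 \<le> m n" using elim assms(7)[of n] by auto
      have V: "1 \<le> V n" "V n \<le> exp (A * ln (real n) ^ 2)"
        unfolding V_def A_def using n m s elim
        by (auto intro!: volume_ratio_ge_1 volume_ratio_le)
      have "contraction_const a b l0 * (V n * ((\<tau> n)\<^sup>2 + exp (real n ^ 2 - b * real n ^ 3)))
          \<le> contraction_const a b l0 * (1 / real n + exp (A * ln (real n) ^ 2) * exp (real n ^ 2 - b * real n ^ 3))"
      proof (rule mult_left_mono)
        have "V n * (\<tau> n)\<^sup>2 = 1 / real n * (1 / (real n * V n))"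
          using V n by (simp add: \<tau>_def power2_eq_square)
        also have "\<dots> \<le> 1 / real n * 1"
          using V n by (intro mult_left_mono) (auto simp: divide_le_eq_1 intro: mult_ge1_I)
        finally show "V n * ((\<tau> n)\<^sup>2 + exp (real n ^ 2 - b * real n ^ 3))
            \<le> 1 / real n + exp (A * ln (real n) ^ 2) * exp (real n ^ 2 - b * real n ^ 3)"
          unfolding distrib_left using V by (intro add_mono mult_right_mono) auto
        show "0 \<le> contraction_const a b l0"
          using assms by (auto simp: contraction_const_def intro!: divide_nonneg_pos mult_nonneg_nonneg add_nonneg_nonneg)
      qed
      then have \<eta>': "contraction_const a b l0 * (volume_ratio s n (m n)
          * ((\<tau> n)\<^sup>2 + exp (real n ^ 2 - b * real n ^ 3))) \<le> \<eta>"
        using elim by (simp add: V_def)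
      \<comment> \<open>Rounding to the grid costs at most half the radius, so
        \<open>\<epsilon> n - 1 / n\<close> is still at least
        \<open>\<epsilon> n / 2\<close>.\<close>
      have eps: "1 / real n \<le> \<epsilon> n / 2"
      proof -
        have "2 / real n = 2 / sqrt (real n) * (1 / sqrt (real n))" using n by simp
        also have "\<dots> \<le> 1 * (1 / sqrt (real n))"
          using elim real_sqrt_le_mono[of 4 "real n"] by (intro mult_right_mono) auto
        also have "\<dots> \<le> \<epsilon> n"
          unfolding \<epsilon>_def using elim \<open>1 < \<gamma>\<close>
          by (simp add: divide_right_mono ge_one_powr_ge_zero)
        finally show ?thesis by simp
      qed
      have eps0: "0 \<le> \<epsilon> n" by (simp add: \<epsilon>_def)
      have "prob {w \<in> space M. \<eta> < \<bar>posterior (prior a b (m n) (al n)) n (\<lambda>i. Z i w)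
          {(l, p). l1_dist (levy l p) (levy l0 p0) \<ge> \<epsilon> n}\<bar>}
        \<le> B / n + n * real (Suc (n ^ 2)) * exp (- real n)
          + real (Suc (n ^ 4 * m n)) ^ m n * (exp (- real n * ((\<epsilon> n - 1 / n) / R)\<^sup>2 / 8) / \<tau> n)"
        unfolding R_def
      proof (rule prob_posterior_gt_le[OF assms(1) simplex _ B _ _ assms(10-12) n(2) m s _ _ _ _ \<eta>'])
        show "K \<le> m n" by fact
        then show "p0 (m n) = 0" by (rule p0_K)
        show "indep_vars (\<lambda>_. count_space UNIV) Z {1..n}"
          using assms(5) by (rule indep_vars_subset) auto
        show "0 < \<tau> n" using V n by (simp add: \<tau>_def)
        show "1 / real n \<le> \<epsilon> n" using eps eps0 by linarith
        have "0 \<le> 1 / real n" by simp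
        with elim show "\<epsilon> n - 1 / real n \<le> 1" by linarith
      qed (use assms(6) al n in auto)
      also have "\<dots> \<le> \<beta> n"
        unfolding \<beta>_def
      proof (rule add_left_mono)
        have "(\<epsilon> n / 2)\<^sup>2 \<le> (\<epsilon> n - 1 / n)\<^sup>2" using eps eps0 by (intro power_mono) auto
        then have "real n * (\<epsilon> n / 2)\<^sup>2 \<le> real n * (\<epsilon> n - 1 / n)\<^sup>2" by (intro mult_left_mono) auto
        moreover have "real n * (\<epsilon> n / 2)\<^sup>2 = (ln (real n) powr \<gamma>)\<^sup>2 / 4"
          using n by (simp add: \<epsilon>_def power_divide)
        ultimately have "(ln (real n) powr \<gamma>)\<^sup>2 / 4 / (8 * R\<^sup>2) \<le> real n * (\<epsilon> n - 1 / n)\<^sup>2 / (8 * R\<^sup>2)"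
          by (intro divide_right_mono) auto
        then have exponent: "- real n * ((\<epsilon> n - 1 / n) / R)\<^sup>2 / 8 \<le> - k * (ln (real n) powr \<gamma>)\<^sup>2"
          by (simp add: k_def power_divide mult.commute)
        have inv: "1 / \<tau> n \<le> exp ((A + 1) * ln (real n) ^ 2)"
        proof -
          have "1 / \<tau> n = exp (ln (real n)) * V n" using n by (simp add: \<tau>_def)
          also have "\<dots> \<le> exp (ln (real n) ^ 2) * exp (A * ln (real n) ^ 2)"
          proof (intro mult_mono V(2))
            show "exp (ln (real n)) \<le> exp (ln (real n) ^ 2)"
              using elim self_le_power[of "ln (real n)" 2] by (simp only: exp_le_cancel_iff)
          qed (use V in auto)
          finally show ?thesis by (simp add: mult_exp_exp algebra_simps)
        qed
        have "real (Suc (n ^ 4 * m n)) ^ m n * (exp (- real n * ((\<epsilon> n - 1 / n) / R)\<^sup>2 / 8) / \<tau> n)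
            \<le> exp (6 * C * ln (real n) ^ 2) * (exp (- k * (ln (real n) powr \<gamma>)\<^sup>2) * exp ((A + 1) * ln (real n) ^ 2))"
        proof (rule mult_mono)
          show "real (Suc (n ^ 4 * m n)) ^ m n \<le> exp (6 * C * ln (real n) ^ 2)"
            using n elim by (intro card_grid_le) auto
          have "exp (- real n * ((\<epsilon> n - 1 / n) / R)\<^sup>2 / 8) * (1 / \<tau> n)
              \<le> exp (- k * (ln (real n) powr \<gamma>)\<^sup>2) * exp ((A + 1) * ln (real n) ^ 2)"
            using exponent inv V n by (intro mult_mono) (auto simp: \<tau>_def)
          then show "exp (- real n * ((\<epsilon> n - 1 / n) / R)\<^sup>2 / 8) / \<tau> n
              \<le> exp (- k * (ln (real n) powr \<gamma>)\<^sup>2) * exp ((A + 1) * ln (real n) ^ 2)" by simp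
          show "0 \<le> exp (- real n * ((\<epsilon> n - 1 / n) / R)\<^sup>2 / 8) / \<tau> n" using V n by (simp add: \<tau>_def)
        qed auto
        also have "\<dots> = exp ((6 * C + A + 1) * ln (real n) ^ 2 - k * (ln (real n) powr \<gamma>)\<^sup>2)"
          by (simp add: mult_exp_exp algebra_simps)
        finally show "real (Suc (n ^ 4 * m n)) ^ m n * (exp (- real n * ((\<epsilon> n - 1 / n) / R)\<^sup>2 / 8) / \<tau> n)
            \<le> exp ((6 * C + A + 1) * ln (real n) ^ 2 - k * (ln (real n) powr \<gamma>)\<^sup>2)" .
      qed
      finally show ?case .
    qed
    then show ?thesis
      by (intro tendsto_sandwich[OF _ _ tendsto_const \<beta>]) auto
  qed
  show ?thesis
    unfolding converges_in_prob_def using main by (auto simp: \<epsilon>_def)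
qed

end
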